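(* Let $G$ be a connected graph with two distinct vertices $v$ and $u$, let $n\geq 1$ be an integer, and let $\mathcal{F}_n$ be the fan-like graph built from $n$ copies of $G$. Write $T(\cdot)=T(\cdot;x,y)$ for the Tutte polynomial and put \begin{align*} A&=\frac{x}{xy-x-y}\big((y-1)T(G)-T(G/\{v,u\})\big),\\ B&=\frac{1}{xy-x-y}\big((x-1)T(G/\{v,u\})-T(G)\big),\\ C&=\frac{1}{xy-x-y}\big((xy-y-1)T(G/\{v,u\})-T(G)\big),\\ \lambda_{1,2}&=\frac{A+C\pm\sqrt{(A-C)^2+4AB}}{2}. \end{align*} Then $$T(\mathcal{F}_{n})=T(G)\frac{\lambda^n_1-\lambda^n_2}{\lambda_1-\lambda_2}+\big((B-C)T(G)+BT(G/\{v,u\})\big)\frac{\lambda^{n-1}_1-\lambda^{n-1}_2}{\lambda_1-\lambda_2},$$ and equivalently \begin{align*} T(\mathcal{F}_n)=&\big((B-C)T(G)+BT(G/\{v,u\})\big)\sum_{j=0}^{\lfloor \frac{n-2}{2}\rfloor}\binom{n-j-2}{j}(A+C)^{n-2j-2}(AB-AC)^{j}\\ &+T(G)\sum_{j=0}^{\lfloor \frac{n-1}{2}\rfloor}\binom{n-j-1}{j}(A+C)^{n-2j-1}(AB-AC)^{j}. \end{align*}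
   Context: Graphs are finite; loops and multiple edges are allowed. The Tutte polynomial of a graph $G=(V,E)$ is $T(G;x,y)=\sum_{S\subseteq E}(x-1)^{r(E)-r(S)}(y-1)^{|S|-r(S)}$, where $r(S)=|V|-\omega(V,S)$ and $\omega(V,S)$ is the number of connected components of $(V,S)$. For $S\subseteq V$, $G/S$ denotes the graph obtained from $G$ by identifying all vertices of $S$ into one new vertex, with all edges preserved (edges inside $S$ become loops). Fan-like graph $\mathcal{F}_n$: let $H_1,\dots,H_n$ be disjoint copies of $G$. Identify the $n$ copies of $v$ into one vertex, and for each $i=1,\dots,n-1$ add an edge $e_i$ joining the copy of $u$ in $H_i$ to the copy of $u$ in $H_{i+1}$. In particular $\mathcal{F}_1=G$. Identities are between elements of an algebraic closure of $\mathbb{Q}(x,y)$; empty sums are $0$. *)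

theory Defs
  imports
    Complex_Main
    "HOL-Computational_Algebra.Computational_Algebra"
    "HOL-Algebra.Algebraic_Closure_Type"
begin

section \<open>Finite multigraphs\<close>

text \<open>An edge is an abstract name with a set of end vertices: two distinct ends for an ordinary
  edge, one for a loop. Parallel edges are distinct names with the same ends.\<close>

record ('v, 'e) mgraph =
  mverts :: "'v set"
  medges :: "'e set"
  mends :: "'e \<Rightarrow> 'v set"

definition multigraph :: "('v, 'e) mgraph \<Rightarrow> bool" where
  "multigraph G \<longleftrightarrow>
     finite (mverts G) \<and> finite (medges G) \<and>
     (\<forall>e \<in> medges G. mends G e \<subseteq> mverts G \<and> card (mends G e) \<in> {1, 2})"

definition same_component :: "('v, 'e) mgraph \<Rightarrow> 'e set \<Rightarrow> ('v \<times> 'v) set" where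
  "same_component G S =
     {(a, b) \<in> mverts G \<times> mverts G. (a, b) \<in> {(c, d). \<exists>e \<in> S. mends G e = {c, d}}\<^sup>*}"

definition num_components :: "('v, 'e) mgraph \<Rightarrow> 'e set \<Rightarrow> nat" where
  "num_components G S = card (mverts G // same_component G S)"

definition connected_mgraph :: "('v, 'e) mgraph \<Rightarrow> bool" where
  "connected_mgraph G \<longleftrightarrow> num_components G (medges G) = 1"


section \<open>The Tutte polynomial\<close>

definition mrank :: "('v, 'e) mgraph \<Rightarrow> 'e set \<Rightarrow> nat" where
  "mrank G S = card (mverts G) - num_components G S"

text \<open>No subtraction of naturals here truncates on a multigraph:
  the number of components is at most the number of vertices, the rank is monotone, and the rank
  of \<open>S\<close> is at most its cardinality.\<close>

definition tutte :: "('v, 'e) mgraph \<Rightarrow> 'a \<Rightarrow> 'a \<Rightarrow> 'a :: comm_ring_1" where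
  "tutte G x y =
     (\<Sum>S \<in> Pow (medges G).
        (x - 1) ^ (mrank G (medges G) - mrank G S) * (y - 1) ^ (card S - mrank G S))"

text \<open>An algebraic closure of \<open>\<rat>(x,y)\<close>. The field of fractions is taken of \<open>\<rat>[x][y]\<close>, so \<open>x\<close> is
  a constant of the outer polynomial ring.\<close>

type_synonym Qxy_closure = "rat poly poly fract alg_closure"

definition indet_x :: Qxy_closure where
  "indet_x = to_ac (to_fract [:[:0, 1:]:])"

definition indet_y :: Qxy_closure where
  "indet_y = to_ac (to_fract [:0, 1:])"


section \<open>Identification of vertices and fan-like graphs\<close>

text \<open>The vertices of \<open>G/S\<close> are the classes of the partition whose only possibly non-trivial
  class is \<open>S\<close>; the set \<open>S\<close> itself is the new vertex. Taking images of the end sets turns the edges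
  inside \<open>S\<close> into loops.\<close>

definition ident_class :: "'v set \<Rightarrow> 'v \<Rightarrow> 'v set" where
  "ident_class S a = (if a \<in> S then S else {a})"

definition identify :: "('v, 'e) mgraph \<Rightarrow> 'v set \<Rightarrow> ('v set, 'e) mgraph" where
  "identify G S =
     \<lparr>mverts = ident_class S ` mverts G, medges = medges G,
      mends = (\<lambda>e. ident_class S ` mends G e)\<rparr>"

definition copies :: "('v, 'e) mgraph \<Rightarrow> nat \<Rightarrow> (nat \<times> 'v, nat \<times> 'e) mgraph" where
  "copies G n =
     \<lparr>mverts = {1..n} \<times> mverts G, medges = {1..n} \<times> medges G,
      mends = (\<lambda>(i, e). Pair i ` mends G e)\<rparr>"

text \<open>\<open>Inl (i, e)\<close> is the copy of \<open>e\<close> in \<open>H\<^sub>i\<close>, and \<open>Inr i\<close> is the added edge \<open>e\<^sub>i\<close>.\<close>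

definition fan_graph ::
  "('v, 'e) mgraph \<Rightarrow> 'v \<Rightarrow> 'v \<Rightarrow> nat \<Rightarrow> ((nat \<times> 'v) set, nat \<times> 'e + nat) mgraph" where
  "fan_graph G v u n =
     (let S = {1..n} \<times> {v}; H = identify (copies G n) S in
      \<lparr>mverts = mverts H,
       medges = Inl ` medges H \<union> Inr ` {1..<n},
       mends = case_sum (mends H) (\<lambda>i. {ident_class S (i, u), ident_class S (Suc i, u)})\<rparr>)"

end

theory Submission
  imports Defs
begin

text \<open>The combinatorial core is a transfer matrix with two states. An edge set of the fan restricts to
  an edge set of each copy of \<open>G\<close> together with a choice of rim edges. When the next copy is attached,
  the change in the number of components depends only on whether the previous rim vertex is connected
  to the hub, and whether the new copy connects \<open>u\<close> to \<open>v\<close> (\<open>two_links\<close>). Because the Tutte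
  polynomial of a connected graph is a constant multiple of the sum of \<open>q ^ k(S) * w ^ |S|\<close>
  (\<open>tutte_state_sum\<close>), it can be computed by splitting this sum according to the state.

  Let \<open>a\<close> and \<open>(x - 1) c\<close> be the contributions to \<open>T(G)\<close> of the edge sets that connect \<open>u\<close> with \<open>v\<close>
  and of those that do not. Then \<open>T(G) = a + (x - 1) c\<close> and \<open>T(G/{v,u}) = (y - 1) a + c\<close>
  (\<open>tutte_parts\<close>), and solving this system identifies the quantities of the theorem: \<open>A = x c\<close>,
  \<open>B = a\<close> and \<open>C = y a + c\<close>. The transfer matrix has rows \<open>(y a + c, x a)\<close> and \<open>(c, x c)\<close>
  (\<open>fan_parts\<close>). Its trace is \<open>A + C\<close> and its determinant is \<open>A C - A B\<close>, so the two values \<open>lam1\<close>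
  and \<open>lam2\<close> are its eigenvalues. The polynomials \<open>T(F\<^sub>n)\<close> therefore satisfy a linear recurrence of
  order two, and both closed forms are expressions for the fundamental solution of that recurrence,
  in the eigenvalues (\<open>lucas_roots\<close>) and in binomial coefficients (\<open>lucas_floor_sums\<close>).

  The first form divides by \<open>lam1 - lam2\<close>, whose square is the discriminant. It does not vanish
  because it equals \<open>(x c - y a - c)\<^sup>2 + 4 x a c\<close>, which is positive at the rational point
  \<open>x = y = 3\<close>, where \<open>a\<close> and \<open>c\<close> are positive (\<open>disc_pos\<close>, \<open>disc_nonzero\<close>).\<close>

section \<open>Connectivity generated by a set of links\<close>

text \<open>The equivalence relation generated by \<open>R\<close>. The symmetric closure is built in, so that one ordered
  pair can stand for an undirected edge.\<close>

definition linked :: "('a \<times> 'a) set \<Rightarrow> ('a \<times> 'a) set" where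
  "linked R = (R \<union> R\<inverse>)\<^sup>*"

text \<open>The classes are counted as an image of \<open>V\<close> and not as a quotient set, so that the number depends
  only on which elements of \<open>V\<close> are linked to each other.\<close>

definition ncomp :: "'a set \<Rightarrow> ('a \<times> 'a) set \<Rightarrow> nat" where
  "ncomp V R = card ((\<lambda>a. linked R `` {a}) ` V)"

lemma linked_refl [simp]: "(a, a) \<in> linked R"
  by (simp add: linked_def)

lemma linked_sym: "(a, b) \<in> linked R \<Longrightarrow> (b, a) \<in> linked R"
  unfolding linked_def by (meson sym_Un_converse sym_rtrancl symD)

lemma linked_trans: "(a, b) \<in> linked R \<Longrightarrow> (b, c) \<in> linked R \<Longrightarrow> (a, c) \<in> linked R"
  unfolding linked_def by (rule rtrancl_trans)

lemma linked_base: "(a, b) \<in> R \<Longrightarrow> (a, b) \<in> linked R"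
  unfolding linked_def by auto

lemma linked_superset: "R \<subseteq> linked R"
  by (auto intro: linked_base)

text \<open>Since \<open>linked R\<close> is the least equivalence relation above \<open>R\<close>, any property of pairs that is an
  equivalence and holds on \<open>R\<close> holds for all linked pairs.\<close>

lemma linked_least:
  assumes "(a, b) \<in> linked R"
    and "\<And>c. P c c" "\<And>c d. P c d \<Longrightarrow> P d c" "\<And>c d e. P c d \<Longrightarrow> P d e \<Longrightarrow> P c e"
    and "\<And>c d. (c, d) \<in> R \<Longrightarrow> P c d"
  shows "P a b"
  using assms(1) unfolding linked_def
  by (induction rule: rtrancl_induct) (use assms in blast)+

lemma linked_mono_closure:
  assumes "R \<subseteq> linked Q" shows "linked R \<subseteq> linked Q"
proof clarify
  fix a b assume "(a, b) \<in> linked R"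
  then show "(a, b) \<in> linked Q"
    by (rule linked_least) (use assms in \<open>auto intro: linked_sym linked_trans\<close>)
qed

lemma linked_mono: "R \<subseteq> Q \<Longrightarrow> linked R \<subseteq> linked Q"
  by (rule linked_mono_closure) (auto intro: linked_base)

lemma linked_eqI: "R \<subseteq> linked Q \<Longrightarrow> Q \<subseteq> linked R \<Longrightarrow> linked R = linked Q"
  by (simp add: linked_mono_closure subset_antisym)

lemma linked_class_eq: "linked R `` {a} = linked R `` {b} \<longleftrightarrow> (a, b) \<in> linked R"
  using linked_sym linked_trans linked_refl by fast

text \<open>A path needs the new link at most once, in one of its two directions.\<close>

lemma linked_insert:
  "(c, d) \<in> linked (insert (a, b) R) \<longleftrightarrow>
     (c, d) \<in> linked R \<or> (c, a) \<in> linked R \<and> (b, d) \<in> linked R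
       \<or> (c, b) \<in> linked R \<and> (a, d) \<in> linked R" (is "_ \<longleftrightarrow> ?P c d")
proof
  assume "(c, d) \<in> linked (insert (a, b) R)"
  then show "?P c d"
  proof (rule linked_least)
    show "?P d c" if "?P c d" for c d using that linked_sym by fast
    show "?P c e" if "?P c d" "?P d e" for c d e using that linked_sym linked_trans by fast
    show "?P c d" if "(c, d) \<in> insert (a, b) R" for c d
      using that linked_base linked_refl by fast
  qed simp
next
  have "linked R \<subseteq> linked (insert (a, b) R)" by (intro linked_mono) auto
  moreover have "(a, b) \<in> linked (insert (a, b) R)" by (simp add: linked_base)
  moreover assume "?P c d"
  ultimately show "(c, d) \<in> linked (insert (a, b) R)"
    using linked_sym linked_trans by (meson subsetD)
qed

text \<open>Both images are in bijection with the quotient of \<open>V\<close> by the common kernel of \<open>f\<close> and \<open>g\<close>.\<close>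

lemma card_image_cong_kernel:
  assumes "\<And>a b. a \<in> V \<Longrightarrow> b \<in> V \<Longrightarrow> f a = f b \<longleftrightarrow> g a = g b"
  shows "card (f ` V) = card (g ` V)"
proof -
  have "bij_betw (\<lambda>K. g (inv_into V f K)) (f ` V) (g ` V)"
  proof (rule bij_betw_byWitness[where f' = "\<lambda>L. f (inv_into V g L)"])
    have F: "f (inv_into V f (f a)) = f a" "inv_into V f (f a) \<in> V" if "a \<in> V" for a
      using that by (auto intro: f_inv_into_f inv_into_into)
    have H: "g (inv_into V g (g a)) = g a" "inv_into V g (g a) \<in> V" if "a \<in> V" for a
      using that by (auto intro: f_inv_into_f inv_into_into)
    show "\<forall>K\<in>f ` V. f (inv_into V g (g (inv_into V f K))) = K"
      using F H assms by (metis (no_types, lifting) imageE)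
    show "\<forall>L\<in>g ` V. g (inv_into V f (f (inv_into V g L))) = L"
      using F H assms by (metis (no_types, lifting) imageE)
    show "(\<lambda>K. g (inv_into V f K)) ` f ` V \<subseteq> g ` V" using F by auto
    show "(\<lambda>L. f (inv_into V g L)) ` g ` V \<subseteq> f ` V" using H by auto
  qed
  then show ?thesis by (rule bij_betw_same_card)
qed

lemma ncomp_insert_linked:
  assumes "(a, b) \<in> linked R" shows "ncomp V (insert (a, b) R) = ncomp V R"
proof -
  have "linked (insert (a, b) R) = linked R"
    using assms by (intro linked_eqI) (auto intro: linked_base)
  then show ?thesis by (simp add: ncomp_def)
qed

text \<open>The new link merges the classes of \<open>a\<close> and \<open>b\<close>. Outside the old class of \<open>b\<close> the old and the new
  partition agree as kernels, and every new class meets that part; so exactly the class of \<open>b\<close> is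
  lost.\<close>

lemma ncomp_insert_unlinked:
  assumes "finite V" "a \<in> V" "b \<in> V" "(a, b) \<notin> linked R"
  shows "ncomp V R = Suc (ncomp V (insert (a, b) R))"
proof -
  let ?c = "\<lambda>x. linked R `` {x}" and ?d = "\<lambda>x. linked (insert (a, b) R) `` {x}"
  let ?U = "{x \<in> V. (x, b) \<notin> linked R}"
  have *: "?c x = ?c y \<longleftrightarrow> ?d x = ?d y" if "x \<in> ?U" "y \<in> ?U" for x y
    using that linked_sym[of b y R] unfolding linked_class_eq linked_insert by blast
  have "card (?c ` ?U) = card (?d ` ?U)" by (rule card_image_cong_kernel) (rule *)
  moreover have "?d ` V = ?d ` ?U"
  proof (intro equalityI subsetI)
    fix K assume "K \<in> ?d ` V"
    then obtain x where x: "x \<in> V" "K = ?d x" by auto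
    show "K \<in> ?d ` ?U"
    proof (cases "(x, b) \<in> linked R")
      case True
      then have "?d x = ?d a" unfolding linked_class_eq linked_insert by simp
      then show ?thesis using assms x by blast
    qed (use x in auto)
  qed auto
  moreover have "?c ` V = insert (?c b) (?c ` ?U)"
    using assms(3) linked_class_eq[of R _ b] by auto
  moreover have "?c b \<notin> ?c ` ?U"
    using linked_class_eq[of R b] linked_sym[of b _ R] by auto
  ultimately show ?thesis using assms(1) by (simp add: ncomp_def)
qed

text \<open>No link leaves \<open>V\<close>, so a path that starts there never meets the links of the other part.\<close>

lemma linked_Un_left:
  assumes "R \<subseteq> V \<times> V" "Q \<subseteq> W \<times> W" "V \<inter> W = {}" "a \<in> V"
  shows "(a, b) \<in> linked (R \<union> Q) \<longleftrightarrow> (a, b) \<in> linked R"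
proof
  let ?P = "\<lambda>c d. (c \<in> V \<longleftrightarrow> d \<in> V) \<and> (c \<in> V \<longrightarrow> (c, d) \<in> linked R)"
  assume "(a, b) \<in> linked (R \<union> Q)"
  then have "?P a b"
  proof (rule linked_least)
    show "?P d c" if "?P c d" for c d using that linked_sym by fast
    show "?P c e" if "?P c d" "?P d e" for c d e using that linked_trans by fast
    show "?P c d" if "(c, d) \<in> R \<union> Q" for c d
      using that assms linked_base by fast
  qed simp
  then show "(a, b) \<in> linked R" using assms by simp
next
  have "linked R \<subseteq> linked (R \<union> Q)" by (intro linked_mono) auto
  then show "(a, b) \<in> linked R \<Longrightarrow> (a, b) \<in> linked (R \<union> Q)" by auto
qed

lemma linked_inside:
  assumes "R \<subseteq> V \<times> V" "(a, b) \<in> linked R" "a \<in> V"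
  shows "b \<in> V"
proof -
  have "a \<in> V \<longleftrightarrow> b \<in> V" using assms(2) by (rule linked_least) (use assms(1) in auto)
  then show ?thesis using assms by simp
qed

lemma ncomp_Un:
  assumes "R \<subseteq> V \<times> V" "Q \<subseteq> W \<times> W" "V \<inter> W = {}" "finite V" "finite W"
  shows "ncomp (V \<union> W) (R \<union> Q) = ncomp V R + ncomp W Q"
proof -
  let ?c = "\<lambda>x. linked (R \<union> Q) `` {x}"
  have V: "(a, b) \<in> linked (R \<union> Q) \<longleftrightarrow> (a, b) \<in> linked R" if "a \<in> V" for a b
    using linked_Un_left[OF assms(1-3) that] .
  have W: "(a, b) \<in> linked (R \<union> Q) \<longleftrightarrow> (a, b) \<in> linked Q" if "a \<in> W" for a b
    using linked_Un_left[OF assms(2,1), of a b] assms(3) that by (simp add: Un_commute Int_commute)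
  have "?c ` V \<inter> ?c ` W = {}"
    using V linked_inside[OF assms(1)] linked_class_eq[of "R \<union> Q"] assms(3) by blast
  moreover have "?c ` V = (\<lambda>x. linked R `` {x}) ` V" "?c ` W = (\<lambda>x. linked Q `` {x}) ` W"
    using V W by (auto intro!: image_cong)
  ultimately show ?thesis using assms(4,5)
    by (simp add: ncomp_def image_Un card_Un_disjoint)
qed

text \<open>Identifying vertices along \<open>f\<close> has the same effect on connectivity as keeping the vertices apart
  and linking those with the same image. This is what allows quotient graphs to be studied on their
  original vertex sets.\<close>

lemma linked_image:
  assumes "R \<subseteq> V \<times> V" "a \<in> V" "b \<in> V"
  shows "(f a, f b) \<in> linked (map_prod f f ` R) \<longleftrightarrow>
           (a, b) \<in> linked (R \<union> {(c, d) \<in> V \<times> V. f c = f d})" (is "_ \<longleftrightarrow> (a, b) \<in> linked ?K")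
proof
  \<comment> \<open>A chain of links in the image is lifted through a choice of preimages; two preimages of the
      same vertex are linked.\<close>
  let ?g = "inv_into V f"
  have g: "(?g (f c), c) \<in> linked ?K" if "c \<in> V" for c
    using that f_inv_into_f[of "f c" f V] inv_into_into[of "f c" f V] by (auto intro: linked_base)
  assume "(f a, f b) \<in> linked (map_prod f f ` R)"
  then have "(?g (f a), ?g (f b)) \<in> linked ?K"
  proof (rule linked_least[where P = "\<lambda>p z. (?g p, ?g z) \<in> linked ?K"])
    show "(?g p, ?g z) \<in> linked ?K" if pz: "(p, z) \<in> map_prod f f ` R" for p z
    proof -
      obtain c d where cd: "(c, d) \<in> R" "p = f c" "z = f d" using pz by auto
      then have "(c, d) \<in> linked ?K" "c \<in> V" "d \<in> V" using assms(1) by (auto intro: linked_base)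
      then show ?thesis
        unfolding cd by (blast intro: linked_trans[OF g linked_trans[OF _ linked_sym[OF g]]])
    qed
  qed (auto intro: linked_sym linked_trans)
  then show "(a, b) \<in> linked ?K"
    using linked_trans[OF linked_sym[OF g] linked_trans[OF _ g]] assms(2,3) by blast
next
  assume "(a, b) \<in> linked ?K"
  then show "(f a, f b) \<in> linked (map_prod f f ` R)"
  proof (rule linked_least)
    show "(f c, f d) \<in> linked (map_prod f f ` R)" if "(c, d) \<in> ?K" for c d
    proof (cases "(c, d) \<in> R")
      case True
      then have "(f c, f d) \<in> map_prod f f ` R" by force
      then show ?thesis by (rule linked_base)
    qed (use that in simp)
  qed (auto intro: linked_sym linked_trans)
qed

lemma ncomp_image:
  assumes "R \<subseteq> V \<times> V"
  shows "ncomp (f ` V) (map_prod f f ` R) = ncomp V (R \<union> {(c, d) \<in> V \<times> V. f c = f d})"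
  unfolding ncomp_def image_image
  by (rule card_image_cong_kernel) (simp add: linked_class_eq linked_image[OF assms])

lemma ncomp_empty: "ncomp V {} = card V"
  unfolding ncomp_def linked_def by (simp add: card_image inj_on_def)

lemma ncomp_le_card: "finite V \<Longrightarrow> ncomp V R \<le> card V"
  unfolding ncomp_def by (rule card_image_le)

lemma ncomp_pos: "finite V \<Longrightarrow> V \<noteq> {} \<Longrightarrow> 0 < ncomp V R"
  unfolding ncomp_def by (simp add: card_gt_0_iff)

lemma linked_if_ncomp_1:
  assumes "ncomp V R = 1" "a \<in> V" "b \<in> V"
  shows "(a, b) \<in> linked R"
proof -
  obtain K where "(\<lambda>a. linked R `` {a}) ` V = {K}"
    using assms(1) card_1_singletonE unfolding ncomp_def by blast
  then have "linked R `` {p} = K" if "p \<in> V" for p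
    using imageI[OF that, of "\<lambda>a. linked R `` {a}"] by simp
  then have "linked R `` {a} = linked R `` {b}" using assms(2,3) by simp
  then show ?thesis by (simp only: linked_class_eq)
qed

lemma linked_image_inj:
  assumes "inj_on f V" "R \<subseteq> V \<times> V" "a \<in> V" "b \<in> V"
  shows "(f a, f b) \<in> linked (map_prod f f ` R) \<longleftrightarrow> (a, b) \<in> linked R"
proof -
  have "linked (R \<union> {(c, d) \<in> V \<times> V. f c = f d}) = linked R"
    by (rule linked_eqI) (use assms(1) in \<open>auto intro: linked_base simp: inj_on_def\<close>)
  then show ?thesis by (simp only: linked_image[OF assms(2-4)])
qed

lemma ncomp_image_inj:
  assumes "inj_on f V" "R \<subseteq> V \<times> V"
  shows "ncomp (f ` V) (map_prod f f ` R) = ncomp V R"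
  unfolding ncomp_def image_image
  by (rule card_image_cong_kernel) (simp add: linked_class_eq linked_image_inj[OF assms])

text \<open>The gluing step of the fan. Think of \<open>a\<close> and \<open>c\<close> as the hubs of two disjoint pieces, and of \<open>b\<close>
  and \<open>d\<close> as their rim vertices. The hub link always merges two components. The rim link then merges
  two more, unless in both pieces the rim is already linked to its hub. In the resulting graph the
  new rim vertex \<open>d\<close> reaches its hub inside its own piece, or through the rim link and the first
  piece.\<close>

lemma two_links:
  assumes R: "R \<subseteq> V \<times> V" "finite V" "a \<in> V" "b \<in> V"
    and Q: "Q \<subseteq> W \<times> W" "finite W" "c \<in> W" "d \<in> W"
    and disj: "V \<inter> W = {}"
  defines "L \<equiv> insert (a, c) (R \<union> Q)"
  shows "ncomp V R + ncomp W Q = Suc (ncomp (V \<union> W) L)"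
    and "(d, c) \<in> linked L \<longleftrightarrow> (d, c) \<in> linked Q"
    and "(b, a) \<in> linked R \<Longrightarrow> (d, c) \<in> linked Q \<Longrightarrow>
           ncomp (V \<union> W) (insert (b, d) L) = ncomp (V \<union> W) L"
    and "\<not> ((b, a) \<in> linked R \<and> (d, c) \<in> linked Q) \<Longrightarrow>
           ncomp (V \<union> W) L = Suc (ncomp (V \<union> W) (insert (b, d) L))"
    and "(d, c) \<in> linked (insert (b, d) L) \<longleftrightarrow> (b, a) \<in> linked R \<or> (d, c) \<in> linked Q"
proof -
  have V: "(p, z) \<in> linked (R \<union> Q) \<longleftrightarrow> (p, z) \<in> linked R" if "p \<in> V" for p z
    using linked_Un_left[OF R(1) Q(1) disj that] .
  have W: "(p, z) \<in> linked (R \<union> Q) \<longleftrightarrow> (p, z) \<in> linked Q" if "p \<in> W" for p z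
    using linked_Un_left[OF Q(1) R(1), of p z] disj that by (simp add: Un_commute Int_commute)
  have VW: "(p, z) \<notin> linked (R \<union> Q)" if "p \<in> V" "z \<in> W" for p z
    using V that disj linked_inside[OF R(1), of p z] by blast
  have WV: "(z, p) \<notin> linked (R \<union> Q)" if "p \<in> V" "z \<in> W" for p z
    using VW[OF that] linked_sym[of z p] by blast
  have sc: "(c, d) \<in> linked Q \<longleftrightarrow> (d, c) \<in> linked Q"
    using linked_sym[of c d] linked_sym[of d c] by blast
  have fin: "finite (V \<union> W)" using R Q by simp
  show "ncomp V R + ncomp W Q = Suc (ncomp (V \<union> W) L)"
    using ncomp_insert_unlinked[OF fin, of a c "R \<union> Q"] VW[OF R(3) Q(3)] R Q
      ncomp_Un[OF R(1) Q(1) disj R(2) Q(2)] by (simp add: L_def)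
  show dc: "(d, c) \<in> linked L \<longleftrightarrow> (d, c) \<in> linked Q"
    unfolding L_def linked_insert using W[OF Q(4)] WV[OF R(3) Q(4)] by auto
  have bd: "(b, d) \<in> linked L \<longleftrightarrow> (b, a) \<in> linked R \<and> (d, c) \<in> linked Q"
    unfolding L_def linked_insert using V[OF R(4)] W[OF Q(3)] VW[OF R(4)] Q(3,4) sc by auto
  show "(b, a) \<in> linked R \<Longrightarrow> (d, c) \<in> linked Q \<Longrightarrow>
           ncomp (V \<union> W) (insert (b, d) L) = ncomp (V \<union> W) L"
    using bd by (intro ncomp_insert_linked) simp
  show "\<not> ((b, a) \<in> linked R \<and> (d, c) \<in> linked Q) \<Longrightarrow>
           ncomp (V \<union> W) L = Suc (ncomp (V \<union> W) (insert (b, d) L))"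
    using bd R Q by (intro ncomp_insert_unlinked) auto
  have bc: "(b, c) \<in> linked L \<longleftrightarrow> (b, a) \<in> linked R"
    unfolding L_def linked_insert using V[OF R(4)] VW[OF R(4) Q(3)] by auto
  show "(d, c) \<in> linked (insert (b, d) L) \<longleftrightarrow> (b, a) \<in> linked R \<or> (d, c) \<in> linked Q"
    unfolding linked_insert[of d c b d L] using dc bc by auto
qed

section \<open>Components of multigraphs and the Tutte polynomial as a state sum\<close>

text \<open>The relation whose reflexive transitive closure underlies \<open>same_component\<close>. It is symmetric, so
  that closure coincides with \<open>linked\<close>.\<close>

definition ends_rel :: "('e \<Rightarrow> 'v set) \<Rightarrow> 'e set \<Rightarrow> ('v \<times> 'v) set" where
  "ends_rel f S = {(c, d). \<exists>e \<in> S. f e = {c, d}}"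

text \<open>Writing the ends as \<open>{a, b}\<close> with possibly equal \<open>a\<close> and \<open>b\<close> treats loops and ordinary edges
  alike, and is preserved by identifying vertices.\<close>

definition proper_edges :: "'v set \<Rightarrow> ('e \<Rightarrow> 'v set) \<Rightarrow> 'e set \<Rightarrow> bool" where
  "proper_edges V f S \<longleftrightarrow> (\<forall>e \<in> S. \<exists>a \<in> V. \<exists>b \<in> V. f e = {a, b})"

lemma ends_rel_Un: "ends_rel f (S \<union> T) = ends_rel f S \<union> ends_rel f T"
  unfolding ends_rel_def by blast

lemma ends_rel_empty [simp]: "ends_rel f {} = {}"
  by (simp add: ends_rel_def)

lemma ends_rel_subset: "proper_edges V f S \<Longrightarrow> ends_rel f S \<subseteq> V \<times> V"
  unfolding ends_rel_def proper_edges_def by (fastforce simp: doubleton_eq_iff)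

lemma proper_edges_subset: "proper_edges V f S \<Longrightarrow> T \<subseteq> S \<Longrightarrow> proper_edges V f T"
  unfolding proper_edges_def by blast

lemma ends_rel_image:
  assumes "proper_edges V f S"
  shows "ends_rel (\<lambda>e. g ` f e) S = map_prod g g ` ends_rel f S"
proof (intro equalityI subrelI)
  fix c d assume "(c, d) \<in> ends_rel (\<lambda>e. g ` f e) S"
  then obtain e a b where e: "e \<in> S" "f e = {a, b}" "{g a, g b} = {c, d}"
    using assms unfolding ends_rel_def proper_edges_def by force
  then have "(a, b) \<in> ends_rel f S" "(b, a) \<in> ends_rel f S"
    unfolding ends_rel_def by (auto simp: insert_commute)
  moreover have "(c, d) = map_prod g g (a, b) \<or> (c, d) = map_prod g g (b, a)"
    using e(3) by (auto simp: doubleton_eq_iff)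
  ultimately show "(c, d) \<in> map_prod g g ` ends_rel f S" by blast
next
  fix c d assume "(c, d) \<in> map_prod g g ` ends_rel f S"
  then show "(c, d) \<in> ends_rel (\<lambda>e. g ` f e) S" unfolding ends_rel_def by force
qed

lemma linked_ends_rel_insert:
  assumes "f e = {a, b}"
  shows "linked (ends_rel f (insert e S)) = linked (insert (a, b) (ends_rel f S))"
proof (rule linked_eqI)
  have "(b, a) \<in> linked (insert (a, b) (ends_rel f S))" by (simp add: linked_base linked_sym)
  then show "ends_rel f (insert e S) \<subseteq> linked (insert (a, b) (ends_rel f S))"
    using assms by (auto simp: ends_rel_def doubleton_eq_iff intro: linked_base)
  show "insert (a, b) (ends_rel f S) \<subseteq> linked (ends_rel f (insert e S))"
    using assms by (auto simp: ends_rel_def intro!: linked_base)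
qed

text \<open>Each edge reduces the number of components by at most one, starting from \<open>card V\<close>. Hence the rank
  of an edge set never exceeds its cardinality.\<close>

lemma card_le_edges_plus_ncomp:
  assumes "finite S" "finite V" "proper_edges V f S"
  shows "card V \<le> card S + ncomp V (ends_rel f S)"
  using assms(1,3)
proof (induction S)
  case empty
  then show ?case by (simp add: ncomp_empty)
next
  case (insert e S)
  then obtain a b where ab: "a \<in> V" "b \<in> V" "f e = {a, b}"
    unfolding proper_edges_def by auto
  let ?R = "ends_rel f S"
  have IH: "card V \<le> card S + ncomp V ?R"
    using insert proper_edges_subset by (metis subset_insertI)
  have "ncomp V ?R \<le> Suc (ncomp V (insert (a, b) ?R))"
    using ncomp_insert_linked[of a b ?R V] ncomp_insert_unlinked[OF assms(2) ab(1,2), of ?R] by force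
  moreover have "ncomp V (ends_rel f (insert e S)) = ncomp V (insert (a, b) ?R)"
    by (simp add: ncomp_def linked_ends_rel_insert[of f, OF ab(3)])
  ultimately show ?case using IH insert by simp
qed

lemma num_components_eq_ncomp:
  "num_components G S = ncomp (mverts G) (ends_rel (mends G) S)"
proof -
  let ?R = "ends_rel (mends G) S" and ?E = "same_component G S"
  have "?R\<inverse> = ?R" by (auto simp: ends_rel_def insert_commute)
  then have "linked ?R = ?R\<^sup>*" by (simp add: linked_def)
  then have E: "?E = {(a, b) \<in> mverts G \<times> mverts G. (a, b) \<in> linked ?R}"
    by (simp add: same_component_def ends_rel_def)
  have "?E `` {a} = ?E `` {b} \<longleftrightarrow> (a, b) \<in> linked ?R" if V: "a \<in> mverts G" "b \<in> mverts G" for a b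
  proof -
    have *: "?E `` {p} = mverts G \<inter> linked ?R `` {p}" if "p \<in> mverts G" for p
      using that by (auto simp: E)
    show ?thesis
    proof
      assume "?E `` {a} = ?E `` {b}"
      moreover have "b \<in> ?E `` {b}" unfolding *[OF V(2)] using V by simp
      ultimately have "b \<in> ?E `` {a}" by (simp only:)
      then show "(a, b) \<in> linked ?R" unfolding *[OF V(1)] by simp
    next
      assume "(a, b) \<in> linked ?R"
      then have "linked ?R `` {a} = linked ?R `` {b}" by (simp only: linked_class_eq)
      then show "?E `` {a} = ?E `` {b}" using V * by simp
    qed
  qed
  moreover have "mverts G // ?E = (\<lambda>a. ?E `` {a}) ` mverts G"
    by (auto simp: quotient_def)
  ultimately show ?thesis
    unfolding num_components_def ncomp_def
    by (simp add: linked_class_eq card_image_cong_kernel)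
qed

lemma multigraph_proper_edges: "multigraph G \<Longrightarrow> proper_edges (mverts G) (mends G) (medges G)"
  unfolding multigraph_def proper_edges_def
proof clarify
  fix e assume "\<forall>e\<in>medges G. mends G e \<subseteq> mverts G \<and> card (mends G e) \<in> {1, 2}" "e \<in> medges G"
  then have "mends G e \<subseteq> mverts G" "card (mends G e) = 1 \<or> card (mends G e) = 2" by auto
  then show "\<exists>a\<in>mverts G. \<exists>b\<in>mverts G. mends G e = {a, b}"
    by (auto simp: card_1_singleton_iff card_2_iff)
qed

text \<open>The classes of \<open>ident_class T\<close> differ from singletons only on \<open>T\<close>, so identifying \<open>T\<close> amounts to
  linking all of its vertices to each other.\<close>

lemma ncomp_ident_class:
  assumes "R \<subseteq> V \<times> V" "T \<subseteq> V"
  shows "ncomp (ident_class T ` V) (map_prod (ident_class T) (ident_class T) ` R)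
           = ncomp V (R \<union> T \<times> T)"
proof -
  let ?K = "{(c, d) \<in> V \<times> V. ident_class T c = ident_class T d}"
  have "c = d \<or> (c, d) \<in> T \<times> T" if "(c, d) \<in> ?K" for c d
    using that by (auto simp: ident_class_def split: if_splits)
  then have "R \<union> ?K \<subseteq> linked (R \<union> T \<times> T)" by (force intro: linked_base)
  moreover have "T \<times> T \<subseteq> ?K" using assms(2) by (auto simp: ident_class_def)
  then have "R \<union> T \<times> T \<subseteq> R \<union> ?K" by (rule Un_mono[OF subset_refl])
  then have "R \<union> T \<times> T \<subseteq> linked (R \<union> ?K)" by (rule subset_trans[OF _ linked_superset])
  ultimately have "linked (R \<union> ?K) = linked (R \<union> T \<times> T)" by (rule linked_eqI)
  then show ?thesis unfolding ncomp_image[OF assms(1)] by (simp add: ncomp_def)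
qed

text \<open>In a connected graph \<open>r(E) - r(S) = k(S) - 1\<close> and \<open>|S| - r(S) = |S| + k(S) - |V|\<close>, where \<open>k\<close> is the
  number of components. So the Tutte polynomial is, up to a factor that does not depend on \<open>S\<close>, the
  sum of \<open>q ^ k(S) * w ^ |S|\<close> with \<open>q = (x - 1) * (y - 1)\<close> and \<open>w = y - 1\<close>. This form suits gluing,
  because component numbers add up to a constant under it.\<close>

lemma tutte_state_sum:
  fixes x y :: "'a :: field"
  assumes fin: "finite (mverts G)" "finite (medges G)"
    and edges: "proper_edges (mverts G) (mends G) (medges G)"
    and conn: "connected_mgraph G" and "x \<noteq> 1" "y \<noteq> 1"
  shows "tutte G x y =
    (\<Sum>S \<in> Pow (medges G). ((x - 1) * (y - 1)) ^ num_components G S * (y - 1) ^ card S)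
      / ((x - 1) * (y - 1) ^ card (mverts G))"
proof -
  let ?m = "card (mverts G)"
  have 1: "num_components G (medges G) = 1" using conn by (simp add: connected_mgraph_def)
  then have ne: "mverts G \<noteq> {}" by (auto simp: num_components_eq_ncomp ncomp_def)
  have "(x - 1) ^ (mrank G (medges G) - mrank G S) * (y - 1) ^ (card S - mrank G S)
      = ((x - 1) * (y - 1)) ^ num_components G S * (y - 1) ^ card S / ((x - 1) * (y - 1) ^ ?m)"
    if S: "S \<subseteq> medges G" for S
  proof -
    let ?k = "num_components G S"
    have k: "0 < ?k" "?k \<le> ?m" "?m \<le> card S + ?k"
      unfolding num_components_eq_ncomp
      using ncomp_pos[OF fin(1) ne] ncomp_le_card[OF fin(1)]
        card_le_edges_plus_ncomp[OF finite_subset[OF S fin(2)] fin(1) proper_edges_subset[OF edges S]]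
      by simp_all
    then have "mrank G (medges G) - mrank G S = ?k - 1" "card S - mrank G S = card S + ?k - ?m"
      by (simp_all add: mrank_def 1)
    moreover have "(x - 1) ^ (?k - 1) * (y - 1) ^ (card S + ?k - ?m) * ((x - 1) * (y - 1) ^ ?m)
        = ((x - 1) ^ (?k - 1) * (x - 1)) * ((y - 1) ^ (card S + ?k - ?m) * (y - 1) ^ ?m)"
      by (simp only: mult.assoc mult.left_commute)
    moreover have "\<dots> = (x - 1) ^ ?k * ((y - 1) ^ card S * (y - 1) ^ ?k)"
      using k(3) power_minus_mult[OF k(1), of "x - 1"] by (simp flip: power_add)
    moreover have "(x - 1) * (y - 1) ^ ?m \<noteq> 0" using assms(5,6) by simp
    ultimately show ?thesis
      by (simp add: nonzero_eq_divide_eq power_mult_distrib mult.assoc mult.left_commute)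
  qed
  then show ?thesis
    unfolding tutte_def sum_divide_distrib by (intro sum.cong) auto
qed

section \<open>State sums\<close>

text \<open>The random cluster partition function, restricted to the edge sets with property \<open>P\<close>.\<close>

definition state_sum ::
  "('e set \<Rightarrow> nat) \<Rightarrow> ('e set \<Rightarrow> bool) \<Rightarrow> 'a \<Rightarrow> 'a \<Rightarrow> 'e set \<Rightarrow> 'a :: comm_ring_1" where
  "state_sum k P q w F = (\<Sum>S \<in> Pow F. if P S then q ^ k S * w ^ card S else 0)"

lemma sum_Pow_Un:
  assumes "A \<inter> B = {}"
  shows "sum g (Pow (A \<union> B)) = (\<Sum>S \<in> Pow A. \<Sum>T \<in> Pow B. g (S \<union> T))"
proof -
  have "bij_betw (\<lambda>(S, T). S \<union> T) (Pow A \<times> Pow B) (Pow (A \<union> B))"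
    by (rule bij_betw_byWitness[where f' = "\<lambda>U. (U \<inter> A, U \<inter> B)"]) (use assms in auto)
  then have "sum g (Pow (A \<union> B)) = (\<Sum>(S, T) \<in> Pow A \<times> Pow B. g (S \<union> T))"
    by (simp add: sum.reindex_bij_betw[symmetric] case_prod_unfold)
  then show ?thesis by (simp add: sum.cartesian_product)
qed

lemma sum_Pow_insert:
  assumes "e \<notin> A"
  shows "sum g (Pow (insert e A)) = (\<Sum>S \<in> Pow A. g S + g (insert e S))"
proof -
  have "Pow {e} = {{}, {e}}" by auto
  then show ?thesis using sum_Pow_Un[of A "{e}" g] assms by simp
qed

lemma sum_Pow_image:
  assumes "inj_on h A"
  shows "sum g (Pow (h ` A)) = (\<Sum>S \<in> Pow A. g (h ` S))"
  by (simp add: image_Pow_surj[symmetric] sum.reindex inj_on_image_Pow assms flip: o_def)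

lemma state_sum_add:
  "state_sum k P q w F + state_sum k (\<lambda>S. \<not> P S) q w F = (\<Sum>S \<in> Pow F. q ^ k S * w ^ card S)"
  unfolding state_sum_def sum.distrib[symmetric] by (intro sum.cong) auto

lemma state_sum_image:
  assumes "inj_on h A" "\<And>S. S \<subseteq> A \<Longrightarrow> k (h ` S) = k' S" "\<And>S. S \<subseteq> A \<Longrightarrow> P (h ` S) = P' S"
  shows "state_sum k P q w (h ` A) = state_sum k' P' q w A"
  unfolding state_sum_def sum_Pow_image[OF assms(1)]
  by (intro sum.cong) (use assms in \<open>auto simp: card_image inj_on_subset\<close>)

text \<open>One step of the transfer matrix, stated for abstract component counts. A configuration on the large
  edge set consists of a configuration \<open>S\<close> of the old part, a configuration \<open>T\<close> of the new piece,
  with edges renamed by \<open>h\<close>, and a decision about the rim edge \<open>e\<close>. Gluing at the hub loses one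
  component, whence the factor \<open>q\<close> on the left. Choosing \<open>e\<close> costs \<open>w\<close>, and also \<open>1 / q\<close> unless \<open>e\<close>
  closes a cycle. The hypotheses have the shape of the conclusions of \<open>two_links\<close>.\<close>

lemma state_sum_step:
  fixes q w :: "'a :: field"
  assumes fin: "finite E" "finite F" and inj: "inj_on h F"
    and disj: "E \<inter> h ` F = {}" "e \<notin> E" "e \<notin> h ` F" and q: "q \<noteq> 0"
    and k0: "\<And>S T. S \<subseteq> E \<Longrightarrow> T \<subseteq> F \<Longrightarrow> k S + k' T = Suc (K (S \<union> h ` T))"
    and k1: "\<And>S T. S \<subseteq> E \<Longrightarrow> T \<subseteq> F \<Longrightarrow> P S \<Longrightarrow> P' T \<Longrightarrow>
               K (insert e (S \<union> h ` T)) = K (S \<union> h ` T)"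
    and k2: "\<And>S T. S \<subseteq> E \<Longrightarrow> T \<subseteq> F \<Longrightarrow> \<not> (P S \<and> P' T) \<Longrightarrow>
               K (S \<union> h ` T) = Suc (K (insert e (S \<union> h ` T)))"
    and p0: "\<And>S T. S \<subseteq> E \<Longrightarrow> T \<subseteq> F \<Longrightarrow> Q (S \<union> h ` T) \<longleftrightarrow> P' T"
    and p1: "\<And>S T. S \<subseteq> E \<Longrightarrow> T \<subseteq> F \<Longrightarrow> Q (insert e (S \<union> h ` T)) \<longleftrightarrow> P S \<or> P' T"
  defines "t \<equiv> state_sum k P q w E" and "s \<equiv> state_sum k (\<lambda>S. \<not> P S) q w E"
    and "a \<equiv> state_sum k' P' q w F" and "b \<equiv> state_sum k' (\<lambda>S. \<not> P' S) q w F"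
  shows "q * state_sum K Q q w (insert e (E \<union> h ` F)) =
           (1 + w) * t * a + (w / q) * t * b + (1 + w / q) * s * a" (is ?th1)
    and "q * state_sum K (\<lambda>S. \<not> Q S) q w (insert e (E \<union> h ` F)) =
           t * b + (1 + w / q) * s * b" (is ?th2)
proof -
  have expand: "state_sum K R q w (insert e (E \<union> h ` F)) =
      (\<Sum>S \<in> Pow E. \<Sum>T \<in> Pow F.
         (if R (S \<union> h ` T) then q ^ K (S \<union> h ` T) * w ^ (card S + card T) else 0) +
         (if R (insert e (S \<union> h ` T))
          then q ^ K (insert e (S \<union> h ` T)) * w ^ Suc (card S + card T) else 0))" for R
  proof -
    have card: "card (S \<union> h ` T) = card S + card T"
      "card (insert e (S \<union> h ` T)) = Suc (card S + card T)" if "S \<subseteq> E" "T \<subseteq> F" for S T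
    proof -
      have "finite S" "finite (h ` T)" "S \<inter> h ` T = {}" "e \<notin> S \<union> h ` T"
        using that fin disj by (auto intro: finite_subset)
      moreover have "card (h ` T) = card T"
        using that inj by (auto intro: card_image inj_on_subset)
      ultimately show "card (S \<union> h ` T) = card S + card T"
        "card (insert e (S \<union> h ` T)) = Suc (card S + card T)"
        by (simp_all add: card_Un_disjoint)
    qed
    have e: "e \<notin> E \<union> h ` F" using disj by auto
    show ?thesis
      unfolding state_sum_def sum_Pow_insert[OF e] sum_Pow_Un[OF disj(1)] sum_Pow_image[OF inj]
      by (intro sum.cong refl) (simp only: card Pow_iff)
  qed
  have weights: "q * q ^ K (S \<union> h ` T) = q ^ k S * q ^ k' T"
    "q * q ^ K (insert e (S \<union> h ` T)) =
       (if P S \<and> P' T then q ^ k S * q ^ k' T else q ^ k S * q ^ k' T / q)"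
    if "S \<subseteq> E" "T \<subseteq> F" for S T
  proof -
    show 1: "q * q ^ K (S \<union> h ` T) = q ^ k S * q ^ k' T"
      using k0[OF that] by (simp flip: power_add)
    show "q * q ^ K (insert e (S \<union> h ` T)) =
       (if P S \<and> P' T then q ^ k S * q ^ k' T else q ^ k S * q ^ k' T / q)"
      using 1 k1[OF that] k2[OF that] q by (auto simp: nonzero_eq_divide_eq mult_ac)
  qed
  have prod: "c * state_sum k R q w E * state_sum k' R' q w F = (\<Sum>S \<in> Pow E. \<Sum>T \<in> Pow F.
      if R S \<and> R' T then c * (q ^ k S * q ^ k' T * w ^ (card S + card T)) else 0)" for c R R'
    unfolding state_sum_def mult.assoc sum_product unfolding sum_distrib_left
    by (intro sum.cong) (auto simp: power_add mult_ac)
  have prod1: "state_sum k R q w E * state_sum k' R' q w F = (\<Sum>S \<in> Pow E. \<Sum>T \<in> Pow F.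
      if R S \<and> R' T then q ^ k S * q ^ k' T * w ^ (card S + card T) else 0)" for R R'
    using prod[of 1 R R'] by (simp only: mult_1_left)
  have g: "q * (if X1 then y1 * u1 else 0) = (if X1 then (q * y1) * u1 else 0)" for X1 and y1 u1 :: 'a
    by simp
  show ?th1
    unfolding t_def s_def a_def b_def prod expand sum_distrib_left distrib_left[of q] g
      sum.distrib[symmetric]
    by (intro sum.cong refl) (auto simp: weights p0 p1 algebra_simps)
  show ?th2
    unfolding t_def s_def a_def b_def prod prod1 expand sum_distrib_left distrib_left[of q] g
      sum.distrib[symmetric]
    by (intro sum.cong refl) (auto simp: weights p0 p1 algebra_simps)
qed

section \<open>The fan before the hub vertices are identified\<close>

text \<open>The same edges as in \<open>fan_graph\<close>, but on the vertices of the disjoint copies.\<close>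

definition fan_ends :: "('e \<Rightarrow> 'v set) \<Rightarrow> 'v \<Rightarrow> nat \<times> 'e + nat \<Rightarrow> (nat \<times> 'v) set" where
  "fan_ends f u = case_sum (\<lambda>(i, e). Pair i ` f e) (\<lambda>i. {(i, u), (Suc i, u)})"

definition fan_edges :: "'e set \<Rightarrow> nat \<Rightarrow> (nat \<times> 'e + nat) set" where
  "fan_edges E n = Inl ` ({1..n} \<times> E) \<union> Inr ` {1..<n}"

text \<open>The identification of the hub vertices is replaced by links between the hubs of consecutive copies.
  In this form the fan with \<open>n + 1\<close> copies contains the fan with \<open>n\<close> copies, whereas the vertex of
  \<open>fan_graph\<close> that represents the hub is a set that changes with \<open>n\<close>.\<close>

definition fan_rel ::
  "('e \<Rightarrow> 'v set) \<Rightarrow> 'v \<Rightarrow> 'v \<Rightarrow> nat \<Rightarrow> (nat \<times> 'e + nat) set \<Rightarrow> ((nat \<times> 'v) \<times> (nat \<times> 'v)) set" where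
  "fan_rel f v u n S = ends_rel (fan_ends f u) S \<union> (\<lambda>i. ((i, v), (Suc i, v))) ` {1..<n}"

lemma proper_fan_edges:
  assumes "proper_edges V f E" "u \<in> V"
  shows "proper_edges ({1..n} \<times> V) (fan_ends f u) (fan_edges E n)"
  unfolding proper_edges_def
proof
  fix e assume "e \<in> fan_edges E n"
  then consider i e' where "e = Inl (i, e')" "i \<in> {1..n}" "e' \<in> E"
    | i where "e = Inr i" "i \<in> {1..<n}" unfolding fan_edges_def by auto
  then show "\<exists>a \<in> {1..n} \<times> V. \<exists>b \<in> {1..n} \<times> V. fan_ends f u e = {a, b}"
  proof cases
    case 1
    then obtain a b where "a \<in> V" "b \<in> V" "f e' = {a, b}"
      using assms unfolding proper_edges_def by blast
    then have "(i, a) \<in> {1..n} \<times> V" "(i, b) \<in> {1..n} \<times> V" "fan_ends f u e = {(i, a), (i, b)}"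
      using 1 by (auto simp: fan_ends_def)
    then show ?thesis by blast
  next
    case 2
    then have "(i, u) \<in> {1..n} \<times> V" "(Suc i, u) \<in> {1..n} \<times> V"
      "fan_ends f u e = {(i, u), (Suc i, u)}" using assms(2) by (auto simp: fan_ends_def)
    then show ?thesis by blast
  qed
qed

lemma ends_rel_copy:
  assumes "proper_edges V f T"
  shows "ends_rel (fan_ends f u) ((\<lambda>e. Inl (i, e)) ` T) = map_prod (Pair i) (Pair i) ` ends_rel f T"
proof -
  have "ends_rel (fan_ends f u) ((\<lambda>e. Inl (i, e)) ` T) = ends_rel (\<lambda>e. Pair i ` f e) T"
    by (auto simp: ends_rel_def fan_ends_def)
  then show ?thesis by (simp add: ends_rel_image[OF assms])
qed

lemma fan_edges_Suc:
  assumes "n \<ge> 1"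
  shows "fan_edges E (Suc n) = insert (Inr n) (fan_edges E n \<union> (\<lambda>e. Inl (Suc n, e)) ` E)"
proof -
  have "{1..Suc n} = insert (Suc n) {1..n}" "{1..<Suc n} = insert n {1..<n}" using assms by auto
  then show ?thesis unfolding fan_edges_def by auto
qed

lemma fan_rel_Suc:
  assumes "n \<ge> 1"
  shows "fan_rel f v u (Suc n) (S \<union> T) =
    insert ((n, v), (Suc n, v)) (fan_rel f v u n S \<union> ends_rel (fan_ends f u) T)"
proof -
  have "{1..<Suc n} = insert n {1..<n}" using assms by auto
  then show ?thesis unfolding fan_rel_def ends_rel_Un by auto
qed

lemma fan_rel_subset:
  assumes "proper_edges V f E" "u \<in> V" "v \<in> V" "S \<subseteq> fan_edges E n"
  shows "fan_rel f v u n S \<subseteq> ({1..n} \<times> V) \<times> ({1..n} \<times> V)"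
proof -
  have "ends_rel (fan_ends f u) S \<subseteq> ({1..n} \<times> V) \<times> ({1..n} \<times> V)"
    using ends_rel_subset[OF proper_edges_subset[OF proper_fan_edges[OF assms(1,2)] assms(4)]] .
  then show ?thesis using assms(3) unfolding fan_rel_def by auto
qed

lemma linked_fan_rel_insert:
  "linked (fan_rel f v u n (insert (Inr i) S)) = linked (insert ((i, u), (Suc i, u)) (fan_rel f v u n S))"
proof (rule linked_eqI)
  let ?R = "fan_rel f v u n S" and ?h = "(\<lambda>i. ((i, v), (Suc i, v))) ` {1..<n}"
  have "linked (ends_rel (fan_ends f u) (insert (Inr i) S))
      = linked (insert ((i, u), (Suc i, u)) (ends_rel (fan_ends f u) S))"
    by (rule linked_ends_rel_insert) (simp add: fan_ends_def)
  then have "ends_rel (fan_ends f u) (insert (Inr i) S)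
      \<subseteq> linked (insert ((i, u), (Suc i, u)) (ends_rel (fan_ends f u) S))"
    using linked_superset by metis
  also have "\<dots> \<subseteq> linked (insert ((i, u), (Suc i, u)) ?R)"
    by (rule linked_mono) (auto simp: fan_rel_def)
  finally show "fan_rel f v u n (insert (Inr i) S) \<subseteq> linked (insert ((i, u), (Suc i, u)) ?R)"
    using linked_superset[of "insert ((i, u), (Suc i, u)) ?R"] by (auto simp: fan_rel_def)
  have "insert ((i, u), (Suc i, u)) ?R \<subseteq> fan_rel f v u n (insert (Inr i) S)"
    by (auto simp: fan_rel_def ends_rel_def fan_ends_def)
  then show "insert ((i, u), (Suc i, u)) ?R \<subseteq> linked (fan_rel f v u n (insert (Inr i) S))"
    by (rule subset_trans[OF _ linked_superset])
qed

section \<open>Configurations of a two-terminal graph and of its fans\<close>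

text \<open>The hub is \<open>v\<close>, the rim vertex is \<open>u\<close>.\<close>

locale two_terminal_graph =
  fixes G :: "('v, 'e) mgraph" and v u :: 'v
  assumes multigraph: "multigraph G" and connected: "connected_mgraph G"
    and terminals: "v \<in> mverts G" "u \<in> mverts G" "v \<noteq> u"
begin

abbreviation "V \<equiv> mverts G"
abbreviation "E \<equiv> medges G"
abbreviation "ends \<equiv> mends G"

lemma finite_graph: "finite V" "finite E"
  using multigraph by (simp_all add: multigraph_def)

lemma proper: "proper_edges V ends E"
  by (rule multigraph_proper_edges[OF multigraph])

lemma proper_sub: "S \<subseteq> E \<Longrightarrow> proper_edges V ends S"
  using proper_edges_subset[OF proper] .

definition comps :: "'e set \<Rightarrow> nat" where
  "comps S = ncomp V (ends_rel ends S)"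

definition joined :: "'e set \<Rightarrow> bool" where
  "joined S \<longleftrightarrow> (u, v) \<in> linked (ends_rel ends S)"

definition fan_comps :: "nat \<Rightarrow> (nat \<times> 'e + nat) set \<Rightarrow> nat" where
  "fan_comps n S = ncomp ({1..n} \<times> V) (fan_rel ends v u n S)"

text \<open>What matters of a configuration for attaching the next copy is only whether the last rim vertex is
  connected to the hub.\<close>

definition fan_joined :: "nat \<Rightarrow> (nat \<times> 'e + nat) set \<Rightarrow> bool" where
  "fan_joined n S \<longleftrightarrow> ((n, u), (n, v)) \<in> linked (fan_rel ends v u n S)"

lemma comps_all: "comps E = 1" "joined E"
proof -
  show "comps E = 1"
    using connected by (simp add: connected_mgraph_def num_components_eq_ncomp comps_def)
  then show "joined E"
    unfolding comps_def joined_def using linked_if_ncomp_1 terminals by metis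
qed

lemma copy_comps:
  assumes "T \<subseteq> E"
  shows "ncomp ({i} \<times> V) (map_prod (Pair i) (Pair i) ` ends_rel ends T) = comps T"
    and "((i, u), (i, v)) \<in> linked (map_prod (Pair i) (Pair i) ` ends_rel ends T) \<longleftrightarrow> joined T"
proof -
  have inj: "inj_on (Pair i) V" by (simp add: inj_on_def)
  have sub: "ends_rel ends T \<subseteq> V \<times> V" by (rule ends_rel_subset[OF proper_sub[OF assms]])
  have "{i} \<times> V = Pair i ` V" by auto
  then show "ncomp ({i} \<times> V) (map_prod (Pair i) (Pair i) ` ends_rel ends T) = comps T"
    by (simp only: ncomp_image_inj[OF inj sub] comps_def)
  show "((i, u), (i, v)) \<in> linked (map_prod (Pair i) (Pair i) ` ends_rel ends T) \<longleftrightarrow> joined T"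
    unfolding joined_def by (rule linked_image_inj[OF inj sub terminals(2,1)])
qed

lemma fan_one:
  assumes "T \<subseteq> E"
  shows "fan_comps 1 ((\<lambda>e. Inl (1, e)) ` T) = comps T"
    and "fan_joined 1 ((\<lambda>e. Inl (1, e)) ` T) \<longleftrightarrow> joined T"
proof -
  have "fan_rel ends v u 1 ((\<lambda>e. Inl (1, e)) ` T) = map_prod (Pair 1) (Pair 1) ` ends_rel ends T"
    by (simp add: fan_rel_def ends_rel_copy[OF proper_sub[OF assms]])
  moreover have "{1..1::nat} = {1}" by auto
  ultimately show "fan_comps 1 ((\<lambda>e. Inl (1, e)) ` T) = comps T"
    "fan_joined 1 ((\<lambda>e. Inl (1, e)) ` T) \<longleftrightarrow> joined T"
    unfolding fan_comps_def fan_joined_def by (simp_all only: copy_comps[OF assms])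
qed

text \<open>The situation of \<open>two_links\<close>, with the fan of \<open>n\<close> copies as the first piece and the new copy of
  \<open>G\<close> as the second.\<close>

lemma fan_step:
  assumes "n \<ge> 1" "S \<subseteq> fan_edges E n" "T \<subseteq> E"
  defines "U \<equiv> S \<union> (\<lambda>e. Inl (Suc n, e)) ` T"
  shows "fan_comps n S + comps T = Suc (fan_comps (Suc n) U)"
    and "fan_joined (Suc n) U \<longleftrightarrow> joined T"
    and "fan_joined n S \<Longrightarrow> joined T \<Longrightarrow> fan_comps (Suc n) (insert (Inr n) U) = fan_comps (Suc n) U"
    and "\<not> (fan_joined n S \<and> joined T) \<Longrightarrow>
           fan_comps (Suc n) U = Suc (fan_comps (Suc n) (insert (Inr n) U))"
    and "fan_joined (Suc n) (insert (Inr n) U) \<longleftrightarrow> fan_joined n S \<or> joined T"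
proof -
  let ?R = "fan_rel ends v u n S"
  let ?Q = "map_prod (Pair (Suc n)) (Pair (Suc n)) ` ends_rel ends T"
  let ?L = "insert ((n, v), (Suc n, v)) (?R \<union> ?Q)"
  have L: "fan_rel ends v u (Suc n) U = ?L"
    unfolding U_def fan_rel_Suc[OF assms(1)] ends_rel_copy[OF proper_sub[OF assms(3)]] ..
  have L': "linked (fan_rel ends v u (Suc n) (insert (Inr n) U)) = linked (insert ((n, u), (Suc n, u)) ?L)"
    by (simp only: linked_fan_rel_insert L)
  have VW: "{1..Suc n} \<times> V = {1..n} \<times> V \<union> {Suc n} \<times> V" by auto
  have R: "?R \<subseteq> ({1..n} \<times> V) \<times> ({1..n} \<times> V)"
    by (rule fan_rel_subset[OF proper terminals(2,1) assms(2)])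
  have Q: "?Q \<subseteq> ({Suc n} \<times> V) \<times> ({Suc n} \<times> V)"
    using ends_rel_subset[OF proper_sub[OF assms(3)]] by auto
  have mem: "(n, v) \<in> {1..n} \<times> V" "(n, u) \<in> {1..n} \<times> V"
    "(Suc n, v) \<in> {Suc n} \<times> V" "(Suc n, u) \<in> {Suc n} \<times> V"
    using terminals assms(1) by auto
  have fin: "finite ({1..n} \<times> V)" "finite ({Suc n} \<times> V)" using finite_graph by auto
  have disj: "({1..n} \<times> V) \<inter> ({Suc n} \<times> V) = {}" by auto
  note * = two_links[OF R fin(1) mem(1,2) Q fin(2) mem(3,4) disj]
  have defs: "fan_comps n S = ncomp ({1..n} \<times> V) ?R" "comps T = ncomp ({Suc n} \<times> V) ?Q"
    "fan_comps (Suc n) U = ncomp ({1..n} \<times> V \<union> {Suc n} \<times> V) ?L"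
    "fan_comps (Suc n) (insert (Inr n) U) =
       ncomp ({1..n} \<times> V \<union> {Suc n} \<times> V) (insert ((n, u), (Suc n, u)) ?L)"
    "fan_joined n S \<longleftrightarrow> ((n, u), (n, v)) \<in> linked ?R"
    "joined T \<longleftrightarrow> ((Suc n, u), (Suc n, v)) \<in> linked ?Q"
    "fan_joined (Suc n) U \<longleftrightarrow> ((Suc n, u), (Suc n, v)) \<in> linked ?L"
    "fan_joined (Suc n) (insert (Inr n) U) \<longleftrightarrow>
       ((Suc n, u), (Suc n, v)) \<in> linked (insert ((n, u), (Suc n, u)) ?L)"
    by (simp_all only: fan_comps_def fan_joined_def copy_comps[OF assms(3)] L VW L'
        ncomp_def[of _ "fan_rel ends v u (Suc n) (insert (Inr n) U)"]
        ncomp_def[of _ "insert ((n, u), (Suc n, u)) ?L"])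
  show "fan_comps n S + comps T = Suc (fan_comps (Suc n) U)"
    "fan_joined (Suc n) U \<longleftrightarrow> joined T"
    "fan_joined n S \<Longrightarrow> joined T \<Longrightarrow> fan_comps (Suc n) (insert (Inr n) U) = fan_comps (Suc n) U"
    "\<not> (fan_joined n S \<and> joined T) \<Longrightarrow>
           fan_comps (Suc n) U = Suc (fan_comps (Suc n) (insert (Inr n) U))"
    "fan_joined (Suc n) (insert (Inr n) U) \<longleftrightarrow> fan_joined n S \<or> joined T"
    unfolding defs by (fact *)+
qed

lemma fan_comps_empty_Suc:
  assumes "n \<ge> 1"
  shows "fan_comps n {} + card V = Suc (fan_comps (Suc n) {})"
  using fan_step(1)[OF assms, of "{}" "{}"] by (simp add: comps_def ncomp_empty)

lemma fan_edges_1: "fan_edges E 1 = (\<lambda>e. Inl (1, e)) ` E"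
  unfolding fan_edges_def by auto

text \<open>With all edges present, each further copy contributes one component and loses it again at the hub,
  and the rim edge joins vertices that are already linked.\<close>

lemma fan_connected:
  assumes "n \<ge> 1"
  shows "fan_comps n (fan_edges E n) = 1 \<and> fan_joined n (fan_edges E n)"
  using assms
proof (induction n rule: dec_induct)
  case base
  show ?case unfolding fan_edges_1 using fan_one[of E] comps_all by simp
next
  case (step n)
  then have n: "n \<ge> 1" by simp
  show ?case
    unfolding fan_edges_Suc[OF n]
    using fan_step[OF n subset_refl subset_refl] step.IH comps_all by simp
qed

definition joined_sum :: "'a \<Rightarrow> 'a \<Rightarrow> 'a :: comm_ring_1" where
  "joined_sum q w = state_sum comps joined q w E"

definition split_sum :: "'a \<Rightarrow> 'a \<Rightarrow> 'a :: comm_ring_1" where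
  "split_sum q w = state_sum comps (\<lambda>S. \<not> joined S) q w E"

definition fan_joined_sum :: "'a \<Rightarrow> 'a \<Rightarrow> nat \<Rightarrow> 'a :: comm_ring_1" where
  "fan_joined_sum q w n = state_sum (fan_comps n) (fan_joined n) q w (fan_edges E n)"

definition fan_split_sum :: "'a \<Rightarrow> 'a \<Rightarrow> nat \<Rightarrow> 'a :: comm_ring_1" where
  "fan_split_sum q w n = state_sum (fan_comps n) (\<lambda>S. \<not> fan_joined n S) q w (fan_edges E n)"

lemma fan_sum_1:
  "fan_joined_sum q w 1 = joined_sum q w" "fan_split_sum q w 1 = split_sum q w"
proof -
  have inj: "inj_on (\<lambda>e. Inl (1, e)) E" by (simp add: inj_on_def)
  show "fan_joined_sum q w 1 = joined_sum q w" "fan_split_sum q w 1 = split_sum q w"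
    unfolding fan_joined_sum_def joined_sum_def fan_split_sum_def split_sum_def fan_edges_1
    by (rule state_sum_image[OF inj]; use fan_one in simp)+
qed

lemma fan_sum_Suc:
  fixes q w :: "'a :: field"
  assumes n: "n \<ge> 1" and q: "q \<noteq> 0"
  shows "q * fan_joined_sum q w (Suc n) = (1 + w) * fan_joined_sum q w n * joined_sum q w
      + (w / q) * fan_joined_sum q w n * split_sum q w
      + (1 + w / q) * fan_split_sum q w n * joined_sum q w"
    and "q * fan_split_sum q w (Suc n) = fan_joined_sum q w n * split_sum q w
      + (1 + w / q) * fan_split_sum q w n * split_sum q w"
proof -
  have fin: "finite (fan_edges E n)" using finite_graph by (simp add: fan_edges_def)
  have inj: "inj_on (\<lambda>e. Inl (Suc n, e)) E" by (simp add: inj_on_def)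
  have disj: "fan_edges E n \<inter> (\<lambda>e. Inl (Suc n, e)) ` E = {}" "Inr n \<notin> fan_edges E n"
    "Inr n \<notin> (\<lambda>e. Inl (Suc n, e)) ` E"
    by (auto simp: fan_edges_def)
  note step = state_sum_step[OF fin finite_graph(2) inj disj q fan_step(1)[OF n] fan_step(3)[OF n]
    fan_step(4)[OF n] fan_step(2)[OF n] fan_step(5)[OF n], of w]
  show "q * fan_joined_sum q w (Suc n) = (1 + w) * fan_joined_sum q w n * joined_sum q w
      + (w / q) * fan_joined_sum q w n * split_sum q w
      + (1 + w / q) * fan_split_sum q w n * joined_sum q w"
    "q * fan_split_sum q w (Suc n) = fan_joined_sum q w n * split_sum q w
      + (1 + w / q) * fan_split_sum q w n * split_sum q w"
    unfolding fan_joined_sum_def fan_split_sum_def joined_sum_def split_sum_def fan_edges_Suc[OF n]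
    using step by blast+
qed

lemma linked_hub:
  assumes "i \<in> {1..n}"
  shows "((1, v), (i, v)) \<in> linked (fan_rel ends v u n S)"
proof -
  have "1 \<le> i" "i \<le> n" using assms by auto
  then show ?thesis
  proof (induction i rule: dec_induct)
    case (step i)
    then have "((i, v), (Suc i, v)) \<in> fan_rel ends v u n S" by (auto simp: fan_rel_def)
    then show ?case using step linked_trans[OF _ linked_base] by simp
  qed simp
qed

lemma fan_graph_sel:
  "mverts (fan_graph G v u n) = ident_class ({1..n} \<times> {v}) ` ({1..n} \<times> V)"
  "medges (fan_graph G v u n) = fan_edges E n"
  "mends (fan_graph G v u n) = (\<lambda>e. ident_class ({1..n} \<times> {v}) ` fan_ends ends u e)"
  by (auto simp: fan_graph_def Let_def identify_def copies_def fan_edges_def fan_ends_def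
      fun_eq_iff split: sum.split)

text \<open>The hub links generate the same equivalence as linking all copies of \<open>v\<close> to each other.\<close>

lemma num_components_fan_graph:
  assumes "S \<subseteq> fan_edges E n"
  shows "num_components (fan_graph G v u n) S = fan_comps n S"
proof -
  let ?T = "{1..n} \<times> {v}" and ?R = "ends_rel (fan_ends ends u) S" and ?F = "fan_rel ends v u n S"
  have edges: "proper_edges ({1..n} \<times> V) (fan_ends ends u) S"
    by (rule proper_edges_subset[OF proper_fan_edges[OF proper terminals(2)] assms])
  have T: "?T \<subseteq> {1..n} \<times> V" using terminals by auto
  have "linked (?R \<union> ?T \<times> ?T) = linked ?F"
  proof (rule linked_eqI)
    have "?R \<subseteq> linked ?F"
      using linked_superset[of ?F] by (auto simp: fan_rel_def)
    moreover have "(p, z) \<in> linked ?F" if "p \<in> ?T" "z \<in> ?T" for p z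
      using that linked_trans[OF linked_sym[OF linked_hub] linked_hub] by auto
    ultimately show "?R \<union> ?T \<times> ?T \<subseteq> linked ?F" by auto
    have "?F \<subseteq> ?R \<union> ?T \<times> ?T" by (auto simp: fan_rel_def)
    then show "?F \<subseteq> linked (?R \<union> ?T \<times> ?T)" by (rule subset_trans[OF _ linked_superset])
  qed
  then show ?thesis
    unfolding num_components_eq_ncomp fan_graph_sel ends_rel_image[OF edges]
      ncomp_ident_class[OF ends_rel_subset[OF edges] T] fan_comps_def
    by (simp add: ncomp_def)
qed

lemma proper_edges_image: "proper_edges W f S \<Longrightarrow> proper_edges (g ` W) (\<lambda>e. g ` f e) S"
  unfolding proper_edges_def
proof
  fix e assume "\<forall>e\<in>S. \<exists>a\<in>W. \<exists>b\<in>W. f e = {a, b}" "e \<in> S"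
  then obtain a b where "a \<in> W" "b \<in> W" "f e = {a, b}" by blast
  then show "\<exists>a\<in>g ` W. \<exists>b\<in>g ` W. g ` f e = {a, b}" by auto
qed

text \<open>The exponent of \<open>w\<close> is the number of vertices of the fan, expressed as the number of components of
  its empty configuration so that it obeys the same recursion as all other component counts.\<close>

lemma tutte_fan_graph:
  fixes x y :: "'a :: field"
  assumes n: "n \<ge> 1" and "x \<noteq> 1" "y \<noteq> 1"
  defines "q \<equiv> (x - 1) * (y - 1)" and "w \<equiv> y - 1"
  shows "tutte (fan_graph G v u n) x y =
    (fan_joined_sum q w n + fan_split_sum q w n) / ((x - 1) * w ^ fan_comps n {})"
proof -
  let ?F = "fan_graph G v u n"
  have fin: "finite (mverts ?F)" "finite (medges ?F)"
    unfolding fan_graph_sel using finite_graph by (auto simp: fan_edges_def)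
  have edges: "proper_edges (mverts ?F) (mends ?F) (medges ?F)"
    unfolding fan_graph_sel by (rule proper_edges_image[OF proper_fan_edges[OF proper terminals(2)]])
  have conn: "connected_mgraph ?F"
    unfolding connected_mgraph_def fan_graph_sel num_components_fan_graph[OF subset_refl]
    using fan_connected[OF n] by simp
  have "card (mverts ?F) = num_components ?F {}"
    by (simp add: num_components_eq_ncomp ncomp_empty)
  then have card: "card (mverts ?F) = fan_comps n {}" by (simp add: num_components_fan_graph)
  show ?thesis
    unfolding tutte_state_sum[OF fin edges conn assms(2,3)] card
    unfolding fan_joined_sum_def fan_split_sum_def state_sum_add fan_graph_sel q_def w_def
    by (intro arg_cong2[where f = "(/)"] sum.cong refl) (simp add: num_components_fan_graph)
qed

lemma tutte_graph:
  fixes x y :: "'a :: field"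
  assumes "x \<noteq> 1" "y \<noteq> 1"
  defines "q \<equiv> (x - 1) * (y - 1)" and "w \<equiv> y - 1"
  shows "tutte G x y = (joined_sum q w + split_sum q w) / ((x - 1) * w ^ card V)"
  unfolding tutte_state_sum[OF finite_graph proper connected assms(1,2)] joined_sum_def split_sum_def
    state_sum_add q_def w_def by (simp add: comps_def num_components_eq_ncomp)

text \<open>The identification acts as one additional link between \<open>u\<close> and \<open>v\<close>.\<close>

lemma num_components_identify:
  assumes "S \<subseteq> E"
  shows "comps S = num_components (identify G {v, u}) S + (if joined S then 0 else 1)"
proof -
  let ?R = "ends_rel ends S" and ?T = "{v, u}"
  have sub: "?R \<subseteq> V \<times> V" by (rule ends_rel_subset[OF proper_sub[OF assms]])
  have T: "?T \<subseteq> V" using terminals by simp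
  have L: "linked (?R \<union> ?T \<times> ?T) = linked (insert (u, v) ?R)"
  proof (rule linked_eqI)
    have "(u, v) \<in> linked (insert (u, v) ?R)" by (simp add: linked_base)
    then show "?R \<union> ?T \<times> ?T \<subseteq> linked (insert (u, v) ?R)"
      by (auto intro: linked_base linked_sym)
    show "insert (u, v) ?R \<subseteq> linked (?R \<union> ?T \<times> ?T)" by (auto intro: linked_base)
  qed
  have "num_components (identify G ?T) S = ncomp V (?R \<union> ?T \<times> ?T)"
    by (simp only: num_components_eq_ncomp identify_def mgraph.select_convs
        ends_rel_image[OF proper_sub[OF assms]] ncomp_ident_class[OF sub T])
  also have "\<dots> = ncomp V (insert (u, v) ?R)" by (simp only: ncomp_def L)
  finally have "num_components (identify G ?T) S = ncomp V (insert (u, v) ?R)" .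
  then show ?thesis
    using ncomp_insert_linked[of u v ?R V] ncomp_insert_unlinked[OF finite_graph(1) terminals(2,1), of ?R]
    by (simp add: comps_def joined_def)
qed

lemma not_joined_empty: "\<not> joined {}"
  using terminals by (simp add: joined_def linked_def)

lemma tutte_identify:
  fixes x y :: "'a :: field"
  assumes xy: "x \<noteq> 1" "y \<noteq> 1"
  defines "q \<equiv> (x - 1) * (y - 1)" and "w \<equiv> y - 1"
  shows "tutte (identify G {v, u}) x y =
    (w * joined_sum q w + split_sum q w / (x - 1)) / ((x - 1) * w ^ card V)"
proof -
  let ?H = "identify G {v, u}" and ?k = "num_components (identify G {v, u})"
  have H: "mverts ?H = ident_class {v, u} ` V" "medges ?H = E"
    "mends ?H = (\<lambda>e. ident_class {v, u} ` ends e)" by (simp_all add: identify_def)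
  have fin: "finite (mverts ?H)" "finite (medges ?H)" unfolding H using finite_graph by auto
  have edges: "proper_edges (mverts ?H) (mends ?H) (medges ?H)"
    unfolding H by (rule proper_edges_image[OF proper])
  have conn: "connected_mgraph ?H"
    unfolding connected_mgraph_def H
    using num_components_identify[OF subset_refl] comps_all by simp
  have "card (mverts ?H) = ?k {}" by (simp add: num_components_eq_ncomp ncomp_empty)
  then have card: "card V = Suc (card (mverts ?H))"
    using num_components_identify[of "{}"] not_joined_empty by (simp add: comps_def ncomp_empty)
  have q: "q \<noteq> 0" and w: "w \<noteq> 0" and qw: "q = (x - 1) * w" using xy by (auto simp: q_def w_def)
  have k: "q ^ ?k S = (if joined S then q ^ comps S else q ^ comps S / q)" if "S \<subseteq> E" for S
    using num_components_identify[OF that] q by simp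
  have "(\<Sum>S \<in> Pow E. q ^ ?k S * w ^ card S) = joined_sum q w + split_sum q w / q"
    unfolding joined_sum_def split_sum_def state_sum_def sum_divide_distrib sum.distrib[symmetric]
    by (intro sum.cong) (auto simp: k)
  then have "tutte ?H x y = (joined_sum q w + split_sum q w / q) / ((x - 1) * w ^ card (mverts ?H))"
    unfolding tutte_state_sum[OF fin edges conn xy] H q_def w_def by simp
  then show ?thesis using w by (simp add: card qw add_divide_distrib)
qed

end

section \<open>Second-order linear recurrences\<close>

text \<open>The fundamental solution of a recurrence \<open>f(n + 2) = p f(n + 1) + s f(n)\<close>, known as a Lucas
  sequence of the first kind with parameters \<open>p\<close> and \<open>- s\<close>.\<close>

fun lucas :: "'a \<Rightarrow> 'a \<Rightarrow> nat \<Rightarrow> 'a :: comm_ring_1" where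
  "lucas p s 0 = 0"
| "lucas p s (Suc 0) = 1"
| "lucas p s (Suc (Suc n)) = p * lucas p s (Suc n) + s * lucas p s n"

lemma recurrence_lucas:
  fixes f :: "nat \<Rightarrow> 'a :: comm_ring_1"
  assumes "\<And>n. n \<ge> 1 \<Longrightarrow> f (Suc (Suc n)) = p * f (Suc n) + s * f n"
  shows "f (Suc n) = f 1 * lucas p s (Suc n) + (f 2 - p * f 1) * lucas p s n"
proof (induction n rule: induct_nat_012)
  case 1
  then show ?case by (simp add: numeral_2_eq_2 algebra_simps)
next
  case (ge2 n)
  have "f (Suc (Suc (Suc n))) = p * f (Suc (Suc n)) + s * f (Suc n)" by (rule assms) simp
  then show ?case unfolding ge2 lucas.simps(3)[of p s] by (simp add: algebra_simps)
qed simp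

lemma lucas_roots:
  fixes a b :: "'a :: comm_ring_1"
  shows "(a - b) * lucas (a + b) (- (a * b)) n = a ^ n - b ^ n"
proof (induction n rule: induct_nat_012)
  case (ge2 n)
  let ?U = "lucas (a + b) (- (a * b))"
  have "(a - b) * ?U (Suc (Suc n)) = (a + b) * ((a - b) * ?U (Suc n)) - a * b * ((a - b) * ?U n)"
    by (simp only: lucas.simps) (simp add: algebra_simps)
  then show ?case unfolding ge2 by (simp add: algebra_simps)
qed simp_all

text \<open>Summing up to \<open>n\<close> adds only vanishing binomial coefficients and makes Pascal's rule applicable
  without attention to the parity of \<open>n\<close>.\<close>

lemma lucas_sum_all:
  fixes p s :: "'a :: comm_ring_1"
  shows "lucas p s (Suc n) = (\<Sum>j\<le>n. of_nat ((n - j) choose j) * p ^ (n - 2 * j) * s ^ j)"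
proof (induction n rule: induct_nat_012)
  case (ge2 n)
  let ?g = "\<lambda>n j. of_nat ((n - j) choose j) * p ^ (n - 2 * j) * s ^ j"
  let ?h = "\<lambda>j. of_nat ((Suc n - j) choose j) * p ^ (Suc (Suc n) - 2 * j) * s ^ j"
  \<comment> \<open>The truncated exponents differ by one only if \<open>2 * j \<le> Suc n\<close>; otherwise the binomial
      coefficient is zero.\<close>
  have h: "?h j = p * ?g (Suc n) j" for j
  proof (cases "2 * j \<le> Suc n")
    case True
    then have "Suc (Suc n) - 2 * j = Suc (Suc n - 2 * j)" by simp
    then show ?thesis by (simp add: mult_ac)
  qed (simp add: binomial_eq_0)
  have "(\<Sum>j\<le>Suc (Suc n). ?g (Suc (Suc n)) j) = ?g (Suc (Suc n)) 0 + (\<Sum>j\<le>Suc n. ?g (Suc (Suc n)) (Suc j))"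
    by (rule sum.atMost_Suc_shift)
  also have "(\<Sum>j\<le>Suc n. ?g (Suc (Suc n)) (Suc j)) = (\<Sum>j\<le>n. ?g (Suc (Suc n)) (Suc j))"
    by simp
  also have "\<dots> = (\<Sum>j\<le>n. s * ?g n j + ?h (Suc j))"
  proof (rule sum.cong[OF refl])
    fix j assume "j \<in> {..n}"
    then have "Suc (Suc n) - Suc j = Suc (n - j)" by auto
    then show "?g (Suc (Suc n)) (Suc j) = s * ?g n j + ?h (Suc j)"
      by (simp add: algebra_simps)
  qed
  also have "?g (Suc (Suc n)) 0 + \<dots> = s * (\<Sum>j\<le>n. ?g n j) + (?h 0 + (\<Sum>j\<le>n. ?h (Suc j)))"
    by (simp add: sum.distrib sum_distrib_left algebra_simps)
  also have "?h 0 + (\<Sum>j\<le>n. ?h (Suc j)) = (\<Sum>j\<le>Suc n. ?h j)"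
    by (rule sum.atMost_Suc_shift[symmetric])
  also have "\<dots> = p * (\<Sum>j\<le>Suc n. ?g (Suc n) j)"
    by (simp only: h sum_distrib_left)
  finally show ?case using ge2 by simp
qed simp_all

lemma lucas_sum:
  fixes p s :: "'a :: comm_ring_1"
  shows "lucas p s (Suc n) = (\<Sum>j\<le>n div 2. of_nat ((n - j) choose j) * p ^ (n - 2 * j) * s ^ j)"
  unfolding lucas_sum_all
proof (rule sum.mono_neutral_right)
  show "\<forall>j\<in>{..n} - {..n div 2}. of_nat ((n - j) choose j) * p ^ (n - 2 * j) * s ^ j = 0"
  proof
    fix j assume "j \<in> {..n} - {..n div 2}"
    then have "n - j < j" by auto
    then show "of_nat ((n - j) choose j) * p ^ (n - 2 * j) * s ^ j = 0"
      by (simp add: binomial_eq_0)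
  qed
qed auto

lemma half_floor_atMost:
  "{j. int j \<le> \<lfloor>(real (Suc n) - 1) / 2\<rfloor>} = {..n div 2}"
proof -
  have "\<lfloor>(real (Suc n) - 1) / 2\<rfloor> = int (n div 2)"
    using floor_divide_of_nat_eq[of n 2, where 'a = real] by simp
  then show ?thesis by auto
qed

text \<open>For \<open>n = 0\<close> the bound is \<open>-1\<close>, so the index set is empty although \<open>(n - 1) div 2\<close> is zero.\<close>

lemma half_floor_atMost_minus_2:
  "{j. int j \<le> \<lfloor>(real (Suc n) - 2) / 2\<rfloor>} = (if n = 0 then {} else {..(n - 1) div 2})"
proof (cases n)
  case 0
  then have "\<lfloor>(real (Suc n) - 2) / 2\<rfloor> = -1" by (simp add: floor_eq_iff)
  then show ?thesis using 0 by auto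
next
  case (Suc m)
  then have "\<lfloor>(real (Suc n) - 2) / 2\<rfloor> = int (m div 2)"
    using floor_divide_of_nat_eq[of m 2, where 'a = real] by simp
  then show ?thesis using Suc by auto
qed

lemma lucas_floor_sums:
  fixes p s :: "'a :: comm_ring_1"
  assumes "n \<ge> 1"
  shows "(\<Sum>j | int j \<le> \<lfloor>(real n - 1) / 2\<rfloor>.
            of_nat ((n - j - 1) choose j) * p ^ (n - 2 * j - 1) * s ^ j) = lucas p s n"
    and "(\<Sum>j | int j \<le> \<lfloor>(real n - 2) / 2\<rfloor>.
            of_nat ((n - j - 2) choose j) * p ^ (n - 2 * j - 2) * s ^ j) = lucas p s (n - 1)"
proof -
  obtain m where m: "n = Suc m" using assms by (cases n) auto
  show "(\<Sum>j | int j \<le> \<lfloor>(real n - 1) / 2\<rfloor>.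
            of_nat ((n - j - 1) choose j) * p ^ (n - 2 * j - 1) * s ^ j) = lucas p s n"
    unfolding m half_floor_atMost lucas_sum by (intro sum.cong) (auto simp: diff_commute)
  show "(\<Sum>j | int j \<le> \<lfloor>(real n - 2) / 2\<rfloor>.
            of_nat ((n - j - 2) choose j) * p ^ (n - 2 * j - 2) * s ^ j) = lucas p s (n - 1)"
  proof (cases m)
    case (Suc k)
    then show ?thesis
      unfolding m half_floor_atMost_minus_2
      by (simp add: lucas_sum)
  qed (simp add: m half_floor_atMost_minus_2 del: of_nat_Suc)
qed

section \<open>The transfer matrix\<close>

context two_terminal_graph
begin

text \<open>The contributions to \<open>tutte G x y\<close> of the edge sets that connect \<open>u\<close> with \<open>v\<close>, and of those that do
  not. The latter have at least two components and so carry a factor \<open>x - 1\<close>, which is divided out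
  in \<open>split_part\<close>.\<close>

definition joined_part :: "'a \<Rightarrow> 'a \<Rightarrow> 'a :: field" where
  "joined_part x y = joined_sum ((x - 1) * (y - 1)) (y - 1) / ((x - 1) * (y - 1) ^ card V)"

definition split_part :: "'a \<Rightarrow> 'a \<Rightarrow> 'a :: field" where
  "split_part x y = split_sum ((x - 1) * (y - 1)) (y - 1) / ((x - 1)\<^sup>2 * (y - 1) ^ card V)"

text \<open>These two equations determine the parts from the two Tutte polynomials; the determinant of the
  system is \<open>1 - (x - 1) * (y - 1)\<close>, the negative of \<open>x * y - x - y\<close>.\<close>

lemma tutte_parts:
  fixes x y :: "'a :: field"
  assumes "x \<noteq> 1" "y \<noteq> 1"
  shows "tutte G x y = joined_part x y + (x - 1) * split_part x y"
    and "tutte (identify G {v, u}) x y = (y - 1) * joined_part x y + split_part x y"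
  using assms
  by (simp_all add: tutte_graph tutte_identify joined_part_def split_part_def power2_eq_square
      add_divide_distrib)

text \<open>The corresponding parts \<open>t\<close> and \<open>s\<close> of the fan evolve by the matrix with rows
  \<open>(y a + c, x a)\<close> and \<open>(c, x c)\<close>, where \<open>a\<close> and \<open>c\<close> are the parts of \<open>G\<close>.\<close>

lemma fan_parts:
  fixes x y :: "'a :: field"
  assumes xy: "x \<noteq> 1" "y \<noteq> 1"
  obtains t s :: "nat \<Rightarrow> 'a" where
    "t 1 = joined_part x y" "s 1 = split_part x y"
    "\<And>n. n \<ge> 1 \<Longrightarrow> t (Suc n) = (y * joined_part x y + split_part x y) * t n + x * joined_part x y * s n"
    "\<And>n. n \<ge> 1 \<Longrightarrow> s (Suc n) = split_part x y * t n + x * split_part x y * s n"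
    "\<And>n. n \<ge> 1 \<Longrightarrow> tutte (fan_graph G v u n) x y = t n + (x - 1) * s n"
proof
  define z w where "z = x - 1" and "w = y - 1"
  have zw: "z \<noteq> 0" "w \<noteq> 0" using xy by (auto simp: z_def w_def)
  have x: "x = z + 1" and y: "y = w + 1" by (simp_all add: z_def w_def)
  let ?q = "z * w"
  define t s where "t n = fan_joined_sum ?q w n / (z * w ^ fan_comps n {})"
    and "s n = fan_split_sum ?q w n / (z\<^sup>2 * w ^ fan_comps n {})" for n
  have a: "joined_part x y = joined_sum ?q w / (z * w ^ card V)"
    and c: "split_part x y = split_sum ?q w / (z\<^sup>2 * w ^ card V)"
    by (simp_all add: joined_part_def split_part_def z_def w_def)
  have "fan_comps 1 {} = card V" using fan_one(1)[of "{}"] by (simp add: comps_def ncomp_empty)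
  then show "t 1 = joined_part x y" "s 1 = split_part x y"
    by (simp_all only: t_def s_def a c fan_sum_1)
  show "tutte (fan_graph G v u n) x y = t n + (x - 1) * s n" if "n \<ge> 1" for n
    unfolding tutte_fan_graph[OF that xy] t_def s_def z_def[symmetric] w_def[symmetric]
    using zw by (simp add: power2_eq_square add_divide_distrib)
  fix n :: nat assume n: "n \<ge> 1"
  let ?T = "fan_joined_sum ?q w" and ?S = "fan_split_sum ?q w"
    and ?a = "joined_sum ?q w" and ?b = "split_sum ?q w"
  let ?W = "w ^ fan_comps n {}" and ?M = "w ^ card V"
  \<comment> \<open>Gluing at the hub loses one vertex.\<close>
  have W: "w ^ fan_comps (Suc n) {} = ?W * ?M / w"
    using fan_comps_empty_Suc[OF n] zw by (simp add: nonzero_eq_divide_eq flip: power_add power_Suc2)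
  have nz: "?W \<noteq> 0" "?M \<noteq> 0" "?q \<noteq> 0" using zw by auto
  have T: "?T (Suc n) = ((1 + w) * ?T n * ?a + (1 / z) * ?T n * ?b + (1 + 1 / z) * ?S n * ?a) / ?q"
    and S: "?S (Suc n) = (?T n * ?b + (1 + 1 / z) * ?S n * ?b) / ?q"
    using fan_sum_Suc[OF n nz(3), of w] zw nz by (simp_all add: nonzero_eq_divide_eq mult.commute)
  show "t (Suc n) = (y * joined_part x y + split_part x y) * t n + x * joined_part x y * s n"
    unfolding t_def s_def a c T W unfolding x y using zw nz
    by (simp add: divide_simps) (simp add: algebra_simps power2_eq_square)
  show "s (Suc n) = split_part x y * t n + x * split_part x y * s n"
    unfolding t_def s_def a c S W unfolding x y using zw nz
    by (simp add: divide_simps) (simp add: algebra_simps power2_eq_square)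
qed

text \<open>By the theorem of Cayley and Hamilton the fan polynomials satisfy the recurrence with the trace and
  the negated determinant of the transfer matrix as coefficients.\<close>

lemma fan_recurrence:
  fixes x y :: "'a :: field"
  assumes xy: "x \<noteq> 1" "y \<noteq> 1" and n: "n \<ge> 1"
  defines "a \<equiv> joined_part x y" and "c \<equiv> split_part x y"
  defines "F \<equiv> \<lambda>n. tutte (fan_graph G v u n) x y"
  shows "F n = tutte G x y * lucas (x * c + (y * a + c)) (x * c * a - x * c * (y * a + c)) n
    + ((a - (y * a + c)) * tutte G x y + a * tutte (identify G {v, u}) x y)
        * lucas (x * c + (y * a + c)) (x * c * a - x * c * (y * a + c)) (n - 1)"
proof -
  obtain t s where base: "t 1 = a" "s 1 = c"
    and t: "\<And>n. n \<ge> 1 \<Longrightarrow> t (Suc n) = (y * a + c) * t n + x * a * s n"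
    and s: "\<And>n. n \<ge> 1 \<Longrightarrow> s (Suc n) = c * t n + x * c * s n"
    and F: "\<And>n. n \<ge> 1 \<Longrightarrow> F n = t n + (x - 1) * s n"
    using fan_parts[OF xy] unfolding a_def c_def F_def by metis
  let ?p = "x * c + (y * a + c)" and ?s = "x * c * a - x * c * (y * a + c)"
  have rec: "F (Suc (Suc k)) = ?p * F (Suc k) + ?s * F k" if "k \<ge> 1" for k
    using that by (simp add: F t s algebra_simps)
  have 1: "F 1 = tutte G x y" by (simp add: F base[unfolded One_nat_def] tutte_parts[OF xy] a_def c_def)
  have "F 2 = (y * a + c) * a + x * a * c + (x - 1) * (c * a + x * c * c)"
    using F[of 2] t[of 1] s[of 1] base by (simp add: numeral_2_eq_2)
  then have 2: "F 2 - ?p * F 1 = (a - (y * a + c)) * tutte G x y + a * tutte (identify G {v, u}) x y"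
    unfolding 1 tutte_parts[OF xy] a_def[symmetric] c_def[symmetric] by (simp add: algebra_simps)
  obtain m where "n = Suc m" using n by (cases n) auto
  then show ?thesis using recurrence_lucas[of F ?p ?s m, OF rec] unfolding 1 2[unfolded 1] by simp
qed

end

section \<open>The discriminant\<close>

text \<open>The Tutte polynomial has integer coefficients, so it commutes with ring homomorphisms. This moves
  statements between the field of the theorem, the polynomial ring and the rationals.\<close>

lemma tutte_hom:
  fixes h :: "'a :: comm_ring_1 \<Rightarrow> 'b :: comm_ring_1"
  assumes add: "\<And>a b. h (a + b) = h a + h b" and mult: "\<And>a b. h (a * b) = h a * h b"
    and one: "h 1 = 1"
  shows "h (tutte G x y) = tutte G (h x) (h y)"
proof -
  have 0: "h 0 = 0" using add[of 0 0] by simp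
  have diff: "h (a - b) = h a - h b" for a b using add[of "a - b" b] by (simp add: algebra_simps)
  have pow: "h (a ^ n) = h a ^ n" for a n by (induction n) (simp_all add: one mult)
  have sum: "h (sum f A) = (\<Sum>i\<in>A. h (f i))" for f :: "_ \<Rightarrow> 'a" and A
    by (induction A rule: infinite_finite_induct) (simp_all add: 0 add)
  show ?thesis by (simp add: tutte_def sum mult pow diff one)
qed

text \<open>The discriminant \<open>(A - C)\<^sup>2 + 4 A B\<close> multiplied by \<open>(x * y - x - y)\<^sup>2\<close>, which makes it polynomial in
  \<open>x\<close>, \<open>y\<close> and the two Tutte polynomials.\<close>

definition disc :: "'a \<Rightarrow> 'a \<Rightarrow> 'a \<Rightarrow> 'a \<Rightarrow> 'a :: comm_ring_1" where
  "disc x y T T' = (x * ((y - 1) * T - T') - ((x * y - y - 1) * T' - T))\<^sup>2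
     + 4 * (x * ((y - 1) * T - T')) * ((x - 1) * T' - T)"

lemma disc_hom:
  fixes h :: "'a :: comm_ring_1 \<Rightarrow> 'b :: comm_ring_1"
  assumes add: "\<And>a b. h (a + b) = h a + h b" and mult: "\<And>a b. h (a * b) = h a * h b"
    and one: "h 1 = 1"
  shows "h (disc x y T T') = disc (h x) (h y) (h T) (h T')"
proof -
  have diff: "h (a - b) = h a - h b" for a b using add[of "a - b" b] by (simp add: algebra_simps)
  have four: "h 4 = 4" using add[of 1 1] add[of 2 2] one by simp
  show ?thesis unfolding disc_def power2_eq_square by (simp only: add mult diff one four)
qed

text \<open>In terms of the parts the discriminant is \<open>(x c - y a - c)\<^sup>2 + 4 x a c\<close>. At \<open>x = y = 3\<close> the weights
  \<open>q = 4\<close> and \<open>w = 2\<close> are positive; the full edge set shows \<open>a > 0\<close> and the empty one \<open>c > 0\<close>. The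
  point \<open>x = y = 2\<close> would not do, because \<open>x * y - x - y\<close> vanishes there.\<close>

lemma (in two_terminal_graph) disc_pos:
  "disc 3 3 (tutte G 3 3) (tutte (identify G {v, u}) 3 3) > (0 :: rat)"
proof -
  define a c :: rat where "a = joined_part 3 3" and "c = split_part 3 3"
  have "joined_sum 4 2 > (0 :: rat)" "split_sum 4 2 > (0 :: rat)"
    unfolding joined_sum_def split_sum_def state_sum_def
    by (rule sum_pos2[of _ E] sum_pos2[of _ "{}"];
        use finite_graph comps_all not_joined_empty in simp)+
  then have "a > 0" "c > 0" by (simp_all add: a_def c_def joined_part_def split_part_def)
  moreover have "disc 3 3 (tutte G 3 3) (tutte (identify G {v, u}) 3 3)
      = 9 * ((2 * c - 3 * a)\<^sup>2 + 12 * c * a)"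
    by (simp add: tutte_parts a_def[symmetric] c_def[symmetric] disc_def power2_eq_square algebra_simps)
  ultimately show ?thesis by (simp add: add_nonneg_pos)
qed

text \<open>A polynomial with a nonzero value is nonzero, and polynomials embed into the algebraic closure of
  their field of fractions.\<close>

lemma (in two_terminal_graph) disc_nonzero:
  "disc indet_x indet_y (tutte G indet_x indet_y) (tutte (identify G {v, u}) indet_x indet_y) \<noteq> 0"
proof -
  let ?X = "[:[:0, 1:]:] :: rat poly poly" and ?Y = "[:0, 1:] :: rat poly poly"
  let ?h = "\<lambda>p :: rat poly poly. to_ac (to_fract p) :: Qxy_closure"
  let ?ev = "\<lambda>p :: rat poly poly. poly (poly p [:3:]) 3"
  define D where "D = disc ?X ?Y (tutte G ?X ?Y) (tutte (identify G {v, u}) ?X ?Y)"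
  have h: "?h (tutte H ?X ?Y) = tutte H indet_x indet_y" for H :: "('w, 'e) mgraph"
    unfolding indet_x_def indet_y_def by (rule tutte_hom) simp_all
  have ev: "?ev (tutte H ?X ?Y) = tutte H 3 3" for H :: "('w, 'e) mgraph"
  proof -
    have "?ev (tutte H ?X ?Y) = tutte H (?ev ?X) (?ev ?Y)" by (rule tutte_hom) simp_all
    then show ?thesis by simp
  qed
  have "?ev D = disc (?ev ?X) (?ev ?Y) (?ev (tutte G ?X ?Y)) (?ev (tutte (identify G {v, u}) ?X ?Y))"
    unfolding D_def by (rule disc_hom) simp_all
  also have "\<dots> = disc 3 3 (tutte G 3 3) (tutte (identify G {v, u}) 3 3)" unfolding ev by simp
  finally have "?ev D = disc 3 3 (tutte G 3 3) (tutte (identify G {v, u}) 3 3)" .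
  then have "D \<noteq> 0" using disc_pos by auto
  then have "?h D \<noteq> 0" by simp
  moreover have "?h D = disc (?h ?X) (?h ?Y) (?h (tutte G ?X ?Y)) (?h (tutte (identify G {v, u}) ?X ?Y))"
    unfolding D_def by (rule disc_hom) simp_all
  ultimately show ?thesis unfolding h by (simp add: indet_x_def indet_y_def)
qed

lemma indet_generic:
  "indet_x \<noteq> 1" "indet_y \<noteq> 1" "indet_x * indet_y - indet_x - indet_y \<noteq> 0"
proof -
  have *: "to_ac (to_fract p) \<noteq> (0 :: Qxy_closure)" if "poly (poly p [:3:]) 3 \<noteq> 0" for p :: "rat poly poly"
    using that by auto
  have "indet_x - 1 \<noteq> 0" "indet_y - 1 \<noteq> 0" "indet_x * indet_y - indet_x - indet_y \<noteq> 0"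
    using *[of "[:[:0, 1:]:] - 1"] *[of "[:0, 1:] - 1"]
      *[of "[:[:0, 1:]:] * [:0, 1:] - [:[:0, 1:]:] - [:0, 1:]"]
    unfolding indet_x_def indet_y_def to_ac_diff[symmetric] to_ac_mult[symmetric] to_ac_1[symmetric]
      to_fract_1[symmetric] to_fract_diff[symmetric] to_fract_mult[symmetric] by simp_all
  then show "indet_x \<noteq> 1" "indet_y \<noteq> 1" "indet_x * indet_y - indet_x - indet_y \<noteq> 0" by auto
qed

section \<open>The closed forms\<close>

theorem theorem3p1:
  fixes G :: "('v, 'e) mgraph" and v u :: 'v and n :: nat
    and x y TG TGvu A B C r lam1 lam2 :: Qxy_closure
  assumes "multigraph G" and "connected_mgraph G"
    and "v \<in> mverts G" and "u \<in> mverts G" and "v \<noteq> u" and "n \<ge> 1"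
  defines "x \<equiv> indet_x" and "y \<equiv> indet_y"
  defines "TG \<equiv> tutte G x y"
    and "TGvu \<equiv> tutte (identify G {v, u}) x y"
  defines "A \<equiv> x / (x * y - x - y) * ((y - 1) * TG - TGvu)"
    and "B \<equiv> 1 / (x * y - x - y) * ((x - 1) * TGvu - TG)"
    and "C \<equiv> 1 / (x * y - x - y) * ((x * y - y - 1) * TGvu - TG)"
  assumes r: "r ^ 2 = (A - C) ^ 2 + 4 * A * B"
  defines "lam1 \<equiv> (A + C + r) / 2" and "lam2 \<equiv> (A + C - r) / 2"
  shows
    "tutte (fan_graph G v u n) x y =
       TG * ((lam1 ^ n - lam2 ^ n) / (lam1 - lam2)) +
       ((B - C) * TG + B * TGvu) * ((lam1 ^ (n - 1) - lam2 ^ (n - 1)) / (lam1 - lam2))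
     \<and>
     tutte (fan_graph G v u n) x y =
       ((B - C) * TG + B * TGvu) *
         (\<Sum>j | int j \<le> \<lfloor>(real n - 2) / 2\<rfloor>.
            of_nat ((n - j - 2) choose j) * (A + C) ^ (n - 2 * j - 2) * (A * B - A * C) ^ j) +
       TG *
         (\<Sum>j | int j \<le> \<lfloor>(real n - 1) / 2\<rfloor>.
            of_nat ((n - j - 1) choose j) * (A + C) ^ (n - 2 * j - 1) * (A * B - A * C) ^ j)"
proof -
  interpret two_terminal_graph G v u
    using assms(1-5) by unfold_locales
  have xy: "x \<noteq> 1" "y \<noteq> 1" and d: "x * y - x - y \<noteq> 0"
    using indet_generic by (simp_all add: x_def y_def)
  define a c where "a = joined_part x y" and "c = split_part x y"
  have T: "TG = a + (x - 1) * c" "TGvu = (y - 1) * a + c"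
    by (simp_all add: TG_def TGvu_def tutte_parts[OF xy] a_def c_def)
  have A: "A = x * c" and B: "B = a" and C: "C = y * a + c"
  proof -
    have "(y - 1) * TG - TGvu = (x * y - x - y) * c"
      "(x - 1) * TGvu - TG = (x * y - x - y) * a"
      "(x * y - y - 1) * TGvu - TG = (x * y - x - y) * (y * a + c)"
      unfolding T by (simp_all add: algebra_simps)
    then show "A = x * c" "B = a" "C = y * a + c" using d by (simp_all add: A_def B_def C_def)
  qed
  let ?U = "lucas (A + C) (A * B - A * C)"
  have F: "tutte (fan_graph G v u n) x y = TG * ?U n + ((B - C) * TG + B * TGvu) * ?U (n - 1)"
    using fan_recurrence[OF xy assms(6)] unfolding TG_def TGvu_def A B C a_def c_def .
  \<comment> \<open>\<open>r\<close> is the difference of the two roots, so the first closed form needs \<open>r \<noteq> 0\<close>.\<close>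
  have "(x * y - x - y)\<^sup>2 * r\<^sup>2 = disc x y TG TGvu"
  proof -
    let ?d = "x * y - x - y"
    have "?d * A = x * ((y - 1) * TG - TGvu)" "?d * B = (x - 1) * TGvu - TG"
      "?d * C = (x * y - y - 1) * TGvu - TG" using d by (simp_all add: A_def B_def C_def)
    moreover have "?d\<^sup>2 * r\<^sup>2 = (?d * A - ?d * C)\<^sup>2 + 4 * (?d * A) * (?d * B)"
      unfolding r by (simp add: power2_eq_square algebra_simps)
    ultimately show ?thesis by (simp only: disc_def)
  qed
  then have "r \<noteq> 0"
    using disc_nonzero unfolding TG_def TGvu_def x_def y_def by auto
  moreover have diff: "lam1 - lam2 = r" by (simp add: lam1_def lam2_def field_simps)
  moreover have sum: "lam1 + lam2 = A + C" by (simp add: lam1_def lam2_def field_simps)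
  moreover have "4 * (lam1 * lam2) = (A + C)\<^sup>2 - r\<^sup>2"
  proof -
    have "2 * lam1 = A + C + r" "2 * lam2 = A + C - r" by (simp_all add: lam1_def lam2_def)
    then have "(2 * lam1) * (2 * lam2) = (A + C + r) * (A + C - r)" by (simp only:)
    then show ?thesis by (simp add: power2_eq_square algebra_simps)
  qed
  then have "4 * (- (lam1 * lam2)) = 4 * (A * B - A * C)"
    unfolding r by (simp add: power2_eq_square algebra_simps)
  then have "- (lam1 * lam2) = A * B - A * C" by (simp only: mult_cancel_left) simp
  ultimately have U: "?U k = (lam1 ^ k - lam2 ^ k) / (lam1 - lam2)" for k
    using lucas_roots[of lam1 lam2 k] by (simp add: nonzero_eq_divide_eq mult.commute)
  show ?thesis
    unfolding lucas_floor_sums[OF assms(6)] using F unfolding U by (simp add: add.commute)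
qed

end
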